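(* Let $d,T\ge1$, $\beta\in(0,1)$, and let $K$ be a known parameter. Let $Q$ be a real-valued function on prefixes of input streams, writing $Q^t(x)=Q(x^1,\dots,x^t)$ (with $Q^0(x)$ the value on the empty prefix), such that (1) for any item-level neighboring input streams $x,y$, $|Q^t(x)-Q^t(y)|\le1$ for all time steps $t$, and (2) $\sum_{t=1}^T|Q^t(x)-Q^{t-1}(x)|\le K$ for the input streams $x$ considered. Then there exist 1. for any $\epsilon>0$, an item-level $\epsilon$-differentially private algorithm in the continual observation model for computing $Q$ (i.e. outputting an estimate of $Q^t(x)$ at each time $t$) with additive error $O\left(\min\left(K,\sqrt{\epsilon^{-1}K\ln(T/\beta)},\epsilon^{-1}T\log(T/\beta)\right)\right)$ at all time steps with probability at least $1-\beta$; 2. for any $\epsilon>0$ and $\delta\in(0,1)$, an item-level $(\epsilon,\delta)$-differentially private algorithm for computing $Q$ with additive error $O\left(\min\left(K,\left(\epsilon^{-2}K\ln(1/\delta)\ln^2(T/\beta)\right)^{1/3},\epsilon^{-1}\sqrt{T\ln(1/\delta)\log(T/\beta)}\right)\right)$ at all time steps with probability at least $1-\beta$.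
   Context: An input stream of length $T$ is a sequence $x=(x^1,\dots,x^T)$ with $x^t\in\{-1,0,1\}^d$; $T$ is a known upper bound on the number of time steps. Two streams $x,y$ are item-level neighboring if there is an item $i^*$ with $x_i^t=y_i^t$ for all $t$ and all $i\ne i^*$. A continual-observation algorithm outputs at each time $t$ a value depending only on $x^1,\dots,x^t$; $A^T(x)$ is its sequence of outputs. It is item-level $(\epsilon,\delta)$-differentially private if for all item-level neighboring $x,y$ and all sets $S$ of output sequences $\Pr[A^T(x)\in S]\le e^\epsilon\Pr[A^T(y)\in S]+\delta$, and item-level $\epsilon$-differentially private if this holds with $\delta=0$. The additive error is the maximum over time steps of $|\text{output at }t-Q^t(x)|$.
   Formalization: In part 2 the O-constant may depend on arbitrary upper bounds for ε and for δ<1 (uniform in all else); with an absolute constant the claim fails as δ→1 or for ε of order T. *)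

theory Defs
  imports "HOL-Probability.Probability"
begin

text \<open>
  A stream is the list of its updates \<open>x\<^sup>1, \<dots>, x\<^sup>T\<close>, each update being a list of \<open>d\<close> entries
  in \<open>{-1, 0, 1}\<close>. The update at time \<open>t\<close> is \<open>x ! (t - 1)\<close>, the prefix seen at time \<open>t\<close> is
  \<open>take t x\<close>, and \<open>Q\<^sup>t(x)\<close> is \<open>Q (take t x)\<close>; items are numbered from \<open>0\<close> to \<open>d - 1\<close>.
\<close>

type_synonym stream = "int list list"

definition input_streams :: "nat \<Rightarrow> nat \<Rightarrow> stream set" where
  "input_streams d T = {x. length x = T \<and> (\<forall>v\<in>set x. length v = d \<and> set v \<subseteq> {-1, 0, 1})}"

definition item_neighboring :: "nat \<Rightarrow> nat \<Rightarrow> stream \<Rightarrow> stream \<Rightarrow> bool" where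
  "item_neighboring d T x y \<longleftrightarrow>
     x \<in> input_streams d T \<and> y \<in> input_streams d T \<and>
     (\<exists>i<d. \<forall>t<T. \<forall>j<d. j \<noteq> i \<longrightarrow> x ! t ! j = y ! t ! j)"

definition item_sensitivity_le_one :: "nat \<Rightarrow> nat \<Rightarrow> (stream \<Rightarrow> real) \<Rightarrow> bool" where
  "item_sensitivity_le_one d T Q \<longleftrightarrow>
     (\<forall>x y. item_neighboring d T x y \<longrightarrow> (\<forall>t\<in>{1..T}. \<bar>Q (take t x) - Q (take t y)\<bar> \<le> 1))"

definition total_variation :: "nat \<Rightarrow> (stream \<Rightarrow> real) \<Rightarrow> stream \<Rightarrow> real" where
  "total_variation T Q x = (\<Sum>t=1..T. \<bar>Q (take t x) - Q (take (t - 1) x)\<bar>)"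

text \<open>
  A continual-observation algorithm is a probability space \<open>M\<close> of internal random choices,
  drawn once, together with a map \<open>A\<close>: its output at time \<open>t\<close> on the stream \<open>x\<close> is
  \<open>A (take t x) \<omega>\<close>, which depends only on \<open>\<omega>\<close> and on the prefix seen so far. As \<open>\<omega>\<close> is shared
  by all time steps, the outputs at different times may be arbitrarily correlated. The
  points \<open>\<omega>\<close> are sequences of reals, so that \<open>M\<close> can provide as many real random variables
  as desired.
\<close>

definition continual_algorithm ::
    "(nat \<Rightarrow> real) measure \<Rightarrow> (stream \<Rightarrow> (nat \<Rightarrow> real) \<Rightarrow> real) \<Rightarrow> bool" where
  "continual_algorithm M A \<longleftrightarrow> prob_space M \<and> (\<forall>p. A p \<in> borel_measurable M)"

definition output_law ::
    "nat \<Rightarrow> (nat \<Rightarrow> real) measure \<Rightarrow> (stream \<Rightarrow> (nat \<Rightarrow> real) \<Rightarrow> real) \<Rightarrow> stream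
      \<Rightarrow> (nat \<Rightarrow> real) measure" where
  "output_law T M A x =
     distr M (\<Pi>\<^sub>M t\<in>{1..T}. borel) (\<lambda>\<omega>. \<lambda>t\<in>{1..T}. A (take t x) \<omega>)"

definition item_level_dp ::
    "nat \<Rightarrow> nat \<Rightarrow> real \<Rightarrow> real \<Rightarrow> (nat \<Rightarrow> real) measure
      \<Rightarrow> (stream \<Rightarrow> (nat \<Rightarrow> real) \<Rightarrow> real) \<Rightarrow> bool" where
  "item_level_dp d T \<epsilon> \<delta> M A \<longleftrightarrow>
     (\<forall>x y. item_neighboring d T x y \<longrightarrow>
       (\<forall>S\<in>sets (\<Pi>\<^sub>M t\<in>{1..T}. (borel :: real measure)).
          measure (output_law T M A x) S \<le> exp \<epsilon> * measure (output_law T M A y) S + \<delta>))"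

definition item_level_pure_dp ::
    "nat \<Rightarrow> nat \<Rightarrow> real \<Rightarrow> (nat \<Rightarrow> real) measure
      \<Rightarrow> (stream \<Rightarrow> (nat \<Rightarrow> real) \<Rightarrow> real) \<Rightarrow> bool" where
  "item_level_pure_dp d T \<epsilon> M A \<longleftrightarrow> item_level_dp d T \<epsilon> 0 M A"

definition additive_error ::
    "nat \<Rightarrow> (stream \<Rightarrow> real) \<Rightarrow> (stream \<Rightarrow> (nat \<Rightarrow> real) \<Rightarrow> real) \<Rightarrow> stream
      \<Rightarrow> (nat \<Rightarrow> real) \<Rightarrow> real" where
  "additive_error T Q A x \<omega> = Max ((\<lambda>t. \<bar>A (take t x) \<omega> - Q (take t x)\<bar>) ` {1..T})"

definition accurate ::
    "nat \<Rightarrow> (stream \<Rightarrow> real) \<Rightarrow> stream set \<Rightarrow> (nat \<Rightarrow> real) measure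
      \<Rightarrow> (stream \<Rightarrow> (nat \<Rightarrow> real) \<Rightarrow> real) \<Rightarrow> real \<Rightarrow> real \<Rightarrow> bool" where
  "accurate T Q X M A \<alpha> \<beta> \<longleftrightarrow>
     (\<forall>x\<in>X. measure M {\<omega> \<in> space M. additive_error T Q A x \<omega> \<le> \<alpha>} \<ge> 1 - \<beta>)"

text \<open>
  The streams under consideration, those whose total variation is bounded by \<open>K\<close>, form a
  set \<open>X\<close>. Only accuracy is confined to \<open>X\<close>: sensitivity is assumed, and privacy required,
  for all neighboring streams.
\<close>

definition admissible_instance ::
    "nat \<Rightarrow> nat \<Rightarrow> real \<Rightarrow> real \<Rightarrow> (stream \<Rightarrow> real) \<Rightarrow> stream set \<Rightarrow> bool" where
  "admissible_instance d T \<beta> K Q X \<longleftrightarrow>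
     d \<ge> 1 \<and> T \<ge> 1 \<and> 0 < \<beta> \<and> \<beta> < 1 \<and>
     item_sensitivity_le_one d T Q \<and>
     X \<subseteq> input_streams d T \<and> (\<forall>x\<in>X. total_variation T Q x \<le> K)"

definition pure_error_bound :: "nat \<Rightarrow> real \<Rightarrow> real \<Rightarrow> real \<Rightarrow> real" where
  "pure_error_bound T \<beta> K \<epsilon> =
     Min {K, sqrt (K * ln (real T / \<beta>) / \<epsilon>), real T * ln (real T / \<beta>) / \<epsilon>}"

text \<open>
  For the next bound no absolute \<open>O\<close>-constant exists. Take \<open>d = 1\<close>, \<open>K = T\<close> and let \<open>Q\<^sup>t(x)\<close>
  be \<open>1\<close> if \<open>x\<^sup>t = 1\<close> and \<open>0\<close> otherwise. For \<open>T = 1\<close>, \<open>\<epsilon> = 1\<close>, \<open>\<beta> = (1 - \<delta>) / 10\<close> every private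
  algorithm has error at least \<open>1/2\<close>, but the bound tends to \<open>0\<close> as \<open>\<delta>\<close> tends to \<open>1\<close>. For
  \<open>\<delta> = 1/2\<close>, \<open>\<beta> = 1/4\<close>, error below \<open>1/2\<close> requires \<open>\<epsilon>\<close> to be of order \<open>T\<close> (packing the
  \<open>2\<^sup>T\<close> streams over \<open>{0, 1}\<close>), but the bound for \<open>\<epsilon> = T / 10\<close> tends to \<open>0\<close> as \<open>T\<close> grows. The
  constant is therefore chosen after arbitrary upper bounds on \<open>\<epsilon>\<close> and on \<open>\<delta> < 1\<close>, and
  uniformly in everything else.
\<close>

definition approx_error_bound :: "nat \<Rightarrow> real \<Rightarrow> real \<Rightarrow> real \<Rightarrow> real \<Rightarrow> real" where
  "approx_error_bound T \<beta> K \<epsilon> \<delta> =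
     Min {K,
          root 3 (K * ln (1 / \<delta>) * (ln (real T / \<beta>))\<^sup>2 / \<epsilon>\<^sup>2),
          sqrt (real T * ln (1 / \<delta>) * ln (real T / \<beta>)) / \<epsilon>}"

end

theory Submission
  imports Defs
begin

text \<open>
  The published value is kept until \<open>Q\<close> has moved away from it. At time \<open>t\<close> let \<open>w\<^sub>t\<close> be
  \<open>exp (c (f\<^sub>t - \<tau>))\<close>, with \<open>f\<^sub>t\<close> the current error, and let \<open>H\<^sub>t\<close> be the sum of these weights since
  the last update. Updating at time \<open>t\<close> with probability \<open>w\<^sub>t / (1 + H\<^sub>t)\<close> makes the probability of
  no update up to \<open>t\<close> telescope to \<open>1 / (1 + H\<^sub>t)\<close> and that of the next update at \<open>t\<close> to
  \<open>w\<^sub>t / ((1 + H\<^sub>t\<^sub>-\<^sub>1) (1 + H\<^sub>t))\<close>. Since neighbouring streams change every weight by a factor of at most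
  \<open>exp c\<close>, a phase ending in an update to \<open>Q\<close> plus discrete Laplace noise is \<open>4c\<close>-private, however
  long it lasts. Every update reduces the error by order \<open>\<tau>\<close>, and only the variation of \<open>Q\<close>
  increases it, so there are at most \<open>O(K / \<tau>)\<close> updates.

  Composing \<open>k\<close> phases gives \<open>\<epsilon> = O(k c)\<close>, which yields the two nontrivial pure bounds: \<open>k = T\<close> or
  \<open>k\<close> of order \<open>sqrt (K \<epsilon> / ln (T / \<beta>))\<close>. For approximate privacy the phases are composed through
  the Renyi divergence; here \<open>r\<^sup>n\<^sup>+\<^sup>1\<close> is bounded by its chord over \<open>[exp (-4c), exp (4c)]\<close>, because a
  linear bound can be followed step by step through a phase. The bound in \<open>sqrt T\<close> comes from
  independent discrete Gaussian noise on the rounded values. If \<open>T / \<beta> < 2\<close>, then \<open>T = 1\<close>, and a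
  single release with discrete Laplace noise on a fine grid meets all bounds.
\<close>

section \<open>Online kernels and their composition\<close>

text \<open>Histories are lists with the newest entry first.\<close>

primrec run :: "(stream \<Rightarrow> 'a list \<Rightarrow> 'a pmf) \<Rightarrow> stream \<Rightarrow> nat \<Rightarrow> 'a list pmf" where
  "run k x 0 = return_pmf []"
| "run k x (Suc t) =
     bind_pmf (run k x t) (\<lambda>h. map_pmf (\<lambda>a. a # h) (k (take (Suc t) x) h))"

lemma length_run: "h \<in> set_pmf (run k x t) \<Longrightarrow> length h = t"
  by (induction t arbitrary: h) (auto simp: set_bind_pmf)

text \<open>A history determines its own tail, so the mixture over all earlier histories collapses
  to a single term. Likelihood ratios of runs are therefore products over the steps.\<close>

lemma pmf_run_Cons:
  "pmf (run k x (Suc t)) (a # h) = pmf (run k x t) h * pmf (k (take (Suc t) x) h) a"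
proof -
  have eq: "pmf (map_pmf (\<lambda>a. a # h') (k (take (Suc t) x) h')) (a # h) =
      indicator {h} h' * pmf (k (take (Suc t) x) h) a" for h'
  proof (cases "h' = h")
    case True
    then show ?thesis
      using pmf_map_inj'[of "\<lambda>a. a # h" "k (take (Suc t) x) h" a] by (simp add: inj_def)
  next
    case False
    then have "a # h \<notin> (\<lambda>a. a # h') ` set_pmf (k (take (Suc t) x) h')" by auto
    then show ?thesis
      using False by (subst pmf_map_outside) auto
  qed
  show ?thesis
    by (simp add: pmf_bind eq measure_pmf_single)
qed

lemma nn_integral_run_Suc:
  "(\<integral>\<^sup>+h. F h \<partial>run k x (Suc t)) =
     (\<integral>\<^sup>+h. (\<integral>\<^sup>+a. F (a # h) \<partial>k (take (Suc t) x) h) \<partial>run k x t)"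
  by simp

text \<open>
  For \<open>n > 0\<close> and \<open>\<Psi> \<ge> 1\<close> this is adaptive composition of Renyi divergences of order \<open>n + 1\<close>;
  for \<open>n = 0\<close> it is the supermartingale bound behind the accuracy proofs.
\<close>

lemma run_potential:
  fixes k :: "stream \<Rightarrow> 'a list \<Rightarrow> 'a pmf" and \<Psi> :: "'a list \<Rightarrow> ennreal"
  assumes step: "\<And>h. length h < T \<Longrightarrow>
      (\<integral>\<^sup>+a. ennreal ((pmf (k (take (Suc (length h)) x) h) a /
                       pmf (k (take (Suc (length h)) y) h) a) ^ n) * \<Psi> (a # h)
         \<partial>k (take (Suc (length h)) x) h) \<le> \<Psi> h"
    and "t \<le> T"
  shows "(\<integral>\<^sup>+h. ennreal ((pmf (run k x t) h / pmf (run k y t) h) ^ n) * \<Psi> h \<partial>run k x t) \<le> \<Psi> []"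
  using \<open>t \<le> T\<close>
proof (induction t)
  case 0
  then show ?case by simp
next
  case (Suc t)
  have "(\<integral>\<^sup>+h. ennreal ((pmf (run k x (Suc t)) h / pmf (run k y (Suc t)) h) ^ n) * \<Psi> h
          \<partial>run k x (Suc t)) =
    (\<integral>\<^sup>+h. ennreal ((pmf (run k x t) h / pmf (run k y t) h) ^ n) *
      (\<integral>\<^sup>+a. ennreal ((pmf (k (take (Suc t) x) h) a / pmf (k (take (Suc t) y) h) a) ^ n) * \<Psi> (a # h)
         \<partial>k (take (Suc t) x) h) \<partial>run k x t)"
    unfolding nn_integral_run_Suc
    by (intro nn_integral_cong)
       (simp add: nn_integral_cmult[symmetric] pmf_run_Cons ennreal_mult power_mult_distrib
          divide_inverse mult_ac del: run.simps)
  also have "\<dots> \<le> (\<integral>\<^sup>+h. ennreal ((pmf (run k x t) h / pmf (run k y t) h) ^ n) * \<Psi> h \<partial>run k x t)"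
    using Suc.prems length_run[of _ k x t] step
    by (intro nn_integral_mono_AE) (force simp: AE_measure_pmf_iff intro!: mult_left_mono)
  also have "\<dots> \<le> \<Psi> []"
    using Suc by simp
  finally show ?case .
qed

section \<open>From bounds on likelihood ratios to privacy\<close>

text \<open>Sum the pointwise bound over \<open>E\<close>. Here \<open>g\<close> measures what
  escapes multiplicative domination, and its mean under \<open>p\<close> becomes the additive
  \<open>\<delta>\<close>; \<open>g = 0\<close> gives pure privacy.\<close>

lemma prob_le_of_pmf_le:
  fixes p q :: "'a pmf"
  assumes le: "\<And>h. pmf p h \<le> c * pmf q h + g h * pmf p h"
    and nonneg: "0 \<le> c" "\<And>h. 0 \<le> g h" "0 \<le> \<delta>"
    and int: "(\<integral>\<^sup>+h. ennreal (g h) \<partial>p) \<le> ennreal \<delta>"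
  shows "measure_pmf.prob p E \<le> c * measure_pmf.prob q E + \<delta>"
proof -
  have eq: "emeasure (measure_pmf r) E = (\<integral>\<^sup>+h. ennreal (pmf r h) * indicator E h \<partial>count_space UNIV)"
    for r :: "'a pmf"
    by (subst nn_integral_indicator[symmetric]) (auto simp: nn_integral_measure_pmf)
  have "emeasure (measure_pmf p) E \<le> (\<integral>\<^sup>+h. ennreal c * (ennreal (pmf q h) * indicator E h) +
      ennreal (pmf p h) * ennreal (g h) \<partial>count_space UNIV)"
    unfolding eq
  proof (intro nn_integral_mono)
    fix h
    have "ennreal (pmf p h) \<le> ennreal (c * pmf q h + g h * pmf p h)"
      using le by (rule ennreal_leI)
    then show "ennreal (pmf p h) * indicator E h \<le>
        ennreal c * (ennreal (pmf q h) * indicator E h) + ennreal (pmf p h) * ennreal (g h)"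
      using nonneg by (auto simp: indicator_def ennreal_mult mult_ac)
  qed
  also have "\<dots> = ennreal c * emeasure (measure_pmf q) E + (\<integral>\<^sup>+h. ennreal (g h) \<partial>p)"
    by (simp add: nn_integral_add nn_integral_cmult eq[symmetric] nn_integral_measure_pmf)
  also have "\<dots> \<le> ennreal c * emeasure (measure_pmf q) E + ennreal \<delta>"
    using int by (rule add_left_mono)
  finally have "ennreal (measure_pmf.prob p E) \<le> ennreal (c * measure_pmf.prob q E + \<delta>)"
    using nonneg by (simp add: measure_pmf.emeasure_eq_measure ennreal_mult)
  then show ?thesis
    using nonneg by (subst (asm) ennreal_le_iff) auto
qed

text \<open>Markov's inequality for the likelihood ratio: where the ratio exceeds
  \<open>exp \<epsilon>\<close>, its \<open>n\<close>-th power divided by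
  \<open>exp (n * \<epsilon>)\<close> is at least 1, so this quotient can serve as
  \<open>g\<close>.\<close>

lemma approx_dp_of_moment:
  fixes p q :: "'a pmf"
  assumes abs_cont: "\<And>h. pmf q h = 0 \<Longrightarrow> pmf p h = 0"
    and "0 \<le> \<delta>"
    and moment: "(\<integral>\<^sup>+h. ennreal ((pmf p h / pmf q h) ^ n) \<partial>p) \<le> ennreal (exp (real n * \<epsilon>) * \<delta>)"
  shows "measure_pmf.prob p E \<le> exp \<epsilon> * measure_pmf.prob q E + \<delta>"
proof (rule prob_le_of_pmf_le[where g = "\<lambda>h. exp (- (real n * \<epsilon>)) * (pmf p h / pmf q h) ^ n"])
  fix h
  show "pmf p h \<le> exp \<epsilon> * pmf q h + exp (- (real n * \<epsilon>)) * (pmf p h / pmf q h) ^ n * pmf p h"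
  proof (cases "pmf p h \<le> exp \<epsilon> * pmf q h")
    case False
    \<comment> \<open>Division by zero yields 0, so an infinite ratio would go unnoticed in the
      moment; absolute continuity excludes it.\<close>
    then have "pmf q h > 0"
      using abs_cont[of h] pmf_nonneg[of q h] by (cases "pmf q h = 0") auto
    with False have "exp \<epsilon> \<le> pmf p h / pmf q h"
      by (simp add: field_simps)
    then have "exp \<epsilon> ^ n \<le> (pmf p h / pmf q h) ^ n"
      by (intro power_mono) auto
    then have "exp (- (real n * \<epsilon>)) * exp (real n * \<epsilon>) \<le>
        exp (- (real n * \<epsilon>)) * (pmf p h / pmf q h) ^ n"
      by (intro mult_left_mono) (simp_all add: exp_of_nat_mult)
    then have "1 \<le> exp (- (real n * \<epsilon>)) * (pmf p h / pmf q h) ^ n"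
      by (simp flip: exp_add)
    then have "1 * pmf p h \<le> exp (- (real n * \<epsilon>)) * (pmf p h / pmf q h) ^ n * pmf p h"
      by (intro mult_right_mono) auto
    then show ?thesis
      by (smt (verit) exp_gt_zero mult_nonneg_nonneg pmf_nonneg)
  qed (smt (verit) exp_gt_zero mult_nonneg_nonneg pmf_nonneg zero_le_power divide_nonneg_nonneg)
next
  have "(\<integral>\<^sup>+h. ennreal (exp (- (real n * \<epsilon>)) * (pmf p h / pmf q h) ^ n) \<partial>p) =
      ennreal (exp (- (real n * \<epsilon>))) * (\<integral>\<^sup>+h. ennreal ((pmf p h / pmf q h) ^ n) \<partial>p)"
    by (subst nn_integral_cmult[symmetric]) (auto simp: ennreal_mult)
  also have "\<dots> \<le> ennreal (exp (- (real n * \<epsilon>))) * ennreal (exp (real n * \<epsilon>) * \<delta>)"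
    using moment by (rule mult_left_mono) simp
  also have "\<dots> = ennreal \<delta>"
    using \<open>0 \<le> \<delta>\<close> by (simp add: ennreal_mult[symmetric] mult.assoc[symmetric] flip: exp_add)
  finally show "(\<integral>\<^sup>+h. ennreal (exp (- (real n * \<epsilon>)) * (pmf p h / pmf q h) ^ n) \<partial>p) \<le> ennreal \<delta>" .
qed (use \<open>0 \<le> \<delta>\<close> in auto)

section \<open>Joint realization of a kernel on the tree of prefixes\<close>

primrec path :: "(stream \<Rightarrow> 'a) \<Rightarrow> stream \<Rightarrow> nat \<Rightarrow> 'a list" where
  "path s x 0 = []"
| "path s x (Suc t) = s (take (Suc t) x) # path s x t"

lemma path_cong: "(\<And>i. i \<in> {1..t} \<Longrightarrow> s (take i x) = s' (take i y)) \<Longrightarrow> path s x t = path s' y t"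
  by (induction t) auto

text \<open>With the newest entry first, going back from time \<open>T\<close> to time
  \<open>t\<close> means dropping \<open>T - t\<close> entries from the front.\<close>

lemma drop_path: "t \<le> T \<Longrightarrow> drop (T - t) (path s x T) = path s x t"
proof (induction T)
  case (Suc T)
  then show ?case by (cases "t = Suc T") (auto simp: Suc_diff_le)
qed auto

lemma path_take: "t \<le> n \<Longrightarrow> path s (take n x) t = path s x t"
  by (rule path_cong) (auto simp: min_def)

text \<open>
  The outcomes on all input streams are drawn jointly: one sample per node of the finite tree of
  prefixes, the children of a node being drawn according to the outcomes on the path to it.
\<close>

primrec sample_tree :: "nat \<Rightarrow> (stream \<Rightarrow> 'a list \<Rightarrow> 'a pmf) \<Rightarrow> nat \<Rightarrow> (stream \<Rightarrow> 'a) pmf" where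
  "sample_tree d k 0 = return_pmf (\<lambda>_. undefined)"
| "sample_tree d k (Suc t) =
     bind_pmf (sample_tree d k t) (\<lambda>s.
       map_pmf (\<lambda>g p. if length p \<le> t then s p else g p)
         (Pi_pmf (input_streams d (Suc t)) undefined (\<lambda>p. k p (path s p t))))"

lemma finite_input_streams: "finite (input_streams d T)"
proof -
  have "input_streams d T \<subseteq>
      {x. set x \<subseteq> {v. set v \<subseteq> {-1, 0, 1} \<and> length v = d} \<and> length x = T}"
    by (auto simp: input_streams_def)
  then show ?thesis
    by (rule finite_subset) (intro finite_lists_length_eq, auto)
qed

lemma take_input_streams: "x \<in> input_streams d T \<Longrightarrow> t \<le> T \<Longrightarrow> take t x \<in> input_streams d t"
  by (auto simp: input_streams_def dest: in_set_takeD)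

text \<open>Along one branch, each layer contributes a single component of the product distribution,
  and its marginal is the kernel applied to the history on that branch.\<close>

lemma path_sample_tree:
  assumes "x \<in> input_streams d T" "t \<le> T"
  shows "map_pmf (\<lambda>s. path s x t) (sample_tree d k t) = run k x t"
  using \<open>t \<le> T\<close>
proof (induction t)
  case 0
  then show ?case by simp
next
  case (Suc t)
  \<comment> \<open>The new layer alters only prefixes of length above \<open>t\<close>, so the
    older part of the branch is untouched.\<close>
  have "path (\<lambda>p. if length p \<le> t then s p else g p) x (Suc t) = g (take (Suc t) x) # path s x t"
    for s g :: "stream \<Rightarrow> 'a"
    using assms(1) Suc.prems
    by (auto simp: input_streams_def min_def intro!: path_cong)
  then have "map_pmf (\<lambda>s. path s x (Suc t)) (sample_tree d k (Suc t)) =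
    bind_pmf (sample_tree d k t) (\<lambda>s.
       map_pmf (\<lambda>a. a # path s x t) (map_pmf (\<lambda>g. g (take (Suc t) x))
         (Pi_pmf (input_streams d (Suc t)) undefined (\<lambda>p. k p (path s p t)))))"
    by (simp add: map_bind_pmf map_pmf_comp del: path.simps)
  also have "\<dots> = bind_pmf (sample_tree d k t) (\<lambda>s.
       map_pmf (\<lambda>a. a # path s x t) (k (take (Suc t) x) (path s x t)))"
    using take_input_streams[OF assms(1) Suc.prems]
    by (simp add: Pi_pmf_component finite_input_streams path_take)
  also have "\<dots> = run k x (Suc t)"
    using Suc by (simp add: bind_map_pmf flip: Suc.IH)
  finally show ?case .
qed

text \<open>Reduces the existence claim to properties of \<open>run\<close>. The random point is a
  sampled tree, stored as a real sequence whose coordinate at the code of a prefix is the value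
  published there; the algorithm reads off that coordinate.\<close>

lemma realize_kernel:
  fixes k :: "stream \<Rightarrow> 'a list \<Rightarrow> 'a pmf" and out :: "'a list \<Rightarrow> real"
  assumes "1 \<le> T" and X: "X \<subseteq> input_streams d T"
    and priv: "\<And>x y E. item_neighboring d T x y \<Longrightarrow>
      measure_pmf.prob (run k x T) E \<le> exp \<epsilon> * measure_pmf.prob (run k y T) E + \<delta>"
    and acc: "\<And>x. x \<in> X \<Longrightarrow>
      1 - \<beta> \<le> measure_pmf.prob (run k x T)
         {h. \<forall>t\<in>{1..T}. \<bar>out (drop (T - t) h) - Q (take t x)\<bar> \<le> \<alpha>}"
  shows "\<exists>M A. continual_algorithm M A \<and> item_level_dp d T \<epsilon> \<delta> M A \<and> accurate T Q X M A \<alpha> \<beta>"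
proof -
  define enc :: "(stream \<Rightarrow> 'a) \<Rightarrow> nat \<Rightarrow> real"
    where "enc s = (\<lambda>i. out (path s (from_nat i) (length (from_nat i :: stream))))" for s
  define M where "M = measure_pmf (map_pmf enc (sample_tree d k T))"
  define A :: "stream \<Rightarrow> (nat \<Rightarrow> real) \<Rightarrow> real" where "A = (\<lambda>p \<omega>. \<omega> (to_nat p))"
  have law: "measure M {\<omega>. P (\<lambda>t\<in>{1..T}. A (take t x) \<omega>)} =
      measure_pmf.prob (run k x T) {h. P (\<lambda>t\<in>{1..T}. out (drop (T - t) h))}"
    if "x \<in> input_streams d T" for x and P :: "(nat \<Rightarrow> real) \<Rightarrow> bool"
  proof -
    have "(\<lambda>t\<in>{1..T}. A (take t x) (enc s)) = (\<lambda>t\<in>{1..T}. out (drop (T - t) (path s x T)))" for s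
      using that
      by (auto simp: A_def enc_def fun_eq_iff restrict_def drop_path path_take input_streams_def min_def)
    then show ?thesis
      unfolding M_def path_sample_tree[OF that order.refl, symmetric]
      by (simp add: vimage_def)
  qed
  have space: "space M = UNIV" and sets: "sets M = UNIV" by (auto simp: M_def)
  have "continual_algorithm M A"
    unfolding continual_algorithm_def
    by (auto simp: M_def intro: measure_pmf.prob_space_axioms)
  moreover have "item_level_dp d T \<epsilon> \<delta> M A"
    unfolding item_level_dp_def
  proof (intro allI impI ballI)
    fix x y S assume xy: "item_neighboring d T x y" and S: "S \<in> sets (\<Pi>\<^sub>M t\<in>{1..T}. (borel :: real measure))"
    have "measure (output_law T M A z) S =
        measure_pmf.prob (run k z T) {h. (\<lambda>t\<in>{1..T}. out (drop (T - t) h)) \<in> S}"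
      if "z \<in> input_streams d T" for z
    proof -
      have "(\<lambda>\<omega>. \<lambda>t\<in>{1..T}. A (take t z) \<omega>) \<in> M \<rightarrow>\<^sub>M (\<Pi>\<^sub>M t\<in>{1..T}. borel)"
        by (auto simp: M_def space_PiM)
      then show ?thesis
        using S law[OF that, of "\<lambda>f. f \<in> S"]
        by (simp add: output_law_def measure_distr space vimage_def)
    qed
    then show "measure (output_law T M A x) S \<le> exp \<epsilon> * measure (output_law T M A y) S + \<delta>"
      using priv[OF xy] xy by (auto simp: item_neighboring_def)
  qed
  moreover have "accurate T Q X M A \<alpha> \<beta>"
    unfolding accurate_def
  proof
    fix x assume "x \<in> X"
    have "measure M {\<omega>. \<forall>t\<in>{1..T}. \<bar>(\<lambda>t\<in>{1..T}. A (take t x) \<omega>) t - Q (take t x)\<bar> \<le> \<alpha>} =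
       measure_pmf.prob (run k x T)
         {h. \<forall>t\<in>{1..T}. \<bar>(\<lambda>t\<in>{1..T}. out (drop (T - t) h)) t - Q (take t x)\<bar> \<le> \<alpha>}"
      by (rule law[where P = "\<lambda>f. \<forall>t\<in>{1..T}. \<bar>f t - Q (take t x)\<bar> \<le> \<alpha>"]) (use \<open>x \<in> X\<close> X in auto)
    then show "1 - \<beta> \<le> measure M {\<omega> \<in> space M. additive_error T Q A x \<omega> \<le> \<alpha>}"
      using acc[OF \<open>x \<in> X\<close>] \<open>1 \<le> T\<close> by (simp add: additive_error_def space)
  qed
  ultimately show ?thesis by blast
qed

section \<open>Discrete noise\<close>

definition noise :: "(int \<Rightarrow> real) \<Rightarrow> int pmf" where
  "noise f = embed_pmf (\<lambda>n. f n / enn2real (\<integral>\<^sup>+n. ennreal (f n) \<partial>count_space UNIV))"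

text \<open>The normalizing constant stays anonymous: the later arguments only compare values of the
  same distribution, or use that its total mass is 1.\<close>

lemma pmf_noise:
  assumes pos: "\<And>n. 0 < f n" and fin: "(\<integral>\<^sup>+n. ennreal (f n) \<partial>count_space UNIV) < \<infinity>"
  shows "\<exists>Z>0. \<forall>n. pmf (noise f) n = f n / Z"
proof -
  define Z where "Z = enn2real (\<integral>\<^sup>+n. ennreal (f n) \<partial>count_space UNIV)"
  have Z: "(\<integral>\<^sup>+n. ennreal (f n) \<partial>count_space UNIV) = ennreal Z"
    using fin by (simp add: Z_def)
  have "ennreal (f 0) \<le> (\<integral>\<^sup>+n. ennreal (f n) \<partial>count_space UNIV)"
    by (rule nn_integral_ge_point) auto
  then have "f 0 \<le> Z"
    unfolding Z by (subst (asm) ennreal_le_iff) (auto simp: Z_def)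
  then have "Z > 0"
    using pos[of 0] by simp
  moreover have "pmf (noise f) n = f n / Z" for n
    unfolding noise_def Z_def[symmetric]
  proof (rule pmf_embed_pmf)
    show "0 \<le> f n / Z" for n
      using pos[of n] \<open>Z > 0\<close> by simp
    have "(\<integral>\<^sup>+n. ennreal (f n / Z) \<partial>count_space UNIV) =
        (\<integral>\<^sup>+n. ennreal (1 / Z) * ennreal (f n) \<partial>count_space UNIV)"
      using pos \<open>Z > 0\<close> by (intro nn_integral_cong) (simp add: ennreal_mult[symmetric] less_imp_le)
    also have "\<dots> = ennreal (1 / Z) * ennreal Z"
      by (subst nn_integral_cmult) (auto simp: Z)
    finally show "(\<integral>\<^sup>+n. ennreal (f n / Z) \<partial>count_space UNIV) = 1"
      using \<open>Z > 0\<close> by (simp add: ennreal_mult[symmetric])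
  qed
  ultimately show ?thesis by blast
qed

text \<open>Two geometric series, one for each half-line; counting 0 twice is harmless for
  finiteness.\<close>

lemma nn_integral_int_exp_finite:
  assumes "0 < b"
  shows "(\<integral>\<^sup>+n. ennreal (exp (- (b * \<bar>real_of_int n\<bar>))) \<partial>count_space UNIV) < \<infinity>"
proof -
  define F where "F = (\<lambda>n::int. ennreal (exp (- (b * \<bar>real_of_int n\<bar>))))"
  have half: "(\<integral>\<^sup>+n. F n * indicator (range g) n \<partial>count_space UNIV) < \<infinity>"
    if g: "inj g" "\<And>i. \<bar>g i\<bar> = int i" for g :: "nat \<Rightarrow> int"
  proof -
    have "(\<integral>\<^sup>+n. F n * indicator (range g) n \<partial>count_space UNIV) = (\<integral>\<^sup>+n. F n \<partial>count_space (range g))"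
      by (simp add: nn_integral_count_space_indicator)
    also have "\<dots> = (\<integral>\<^sup>+i. F (g i) \<partial>count_space UNIV)"
      using g by (intro nn_integral_bij_count_space[symmetric]) (simp add: bij_betw_def)
    also have "\<dots> = (\<Sum>i. ennreal (exp (-b) ^ i))"
      using g(2) by (subst nn_integral_count_space_nat)
        (simp add: F_def exp_of_nat_mult[symmetric] mult.commute flip: of_int_abs)
    also have "\<dots> = ennreal (\<Sum>i. exp (-b) ^ i)"
      using assms by (intro suminf_ennreal2 summable_geometric) auto
    finally show ?thesis by simp
  qed
  have "n \<in> range int \<or> n \<in> range (\<lambda>i. - int i)" for n
    by (cases n rule: int_cases2) auto
  then have "(\<integral>\<^sup>+n. F n \<partial>count_space UNIV) \<le>
      (\<integral>\<^sup>+n. F n * indicator (range int) n + F n * indicator (range (\<lambda>i. - int i)) n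
        \<partial>count_space UNIV)"
    by (intro nn_integral_mono) (auto simp: indicator_def)
  also have "\<dots> < \<infinity>"
    using half[of int] half[of "\<lambda>i. - int i"]
    by (subst nn_integral_add) (auto simp: inj_def)
  finally show ?thesis by (simp add: F_def)
qed

text \<open>
  The map \<open>i \<mapsto> i + sgn i * j\<close> is a bijection from the nonzero integers onto those of absolute
  value above \<open>j\<close>, so that the normalizing constant plays no role.
\<close>

lemma pmf_tail_le:
  fixes p :: "int pmf"
  assumes decay: "\<And>i. i \<noteq> 0 \<Longrightarrow> pmf p (i + sgn i * int j) \<le> g * pmf p i" and "0 \<le> g"
  shows "measure_pmf.prob p {n. int j < \<bar>n\<bar>} \<le> g"
proof -
  let ?\<phi> = "\<lambda>i. i + sgn i * int j"
  have inj: "inj_on ?\<phi> {i. i \<noteq> 0}"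
    by (auto simp: inj_on_def sgn_if split: if_splits)
  have "{n. int j < \<bar>n\<bar>} \<subseteq> ?\<phi> ` {i. i \<noteq> 0}"
  proof
    fix n assume n: "n \<in> {n. int j < \<bar>n\<bar>}"
    then have "n = ?\<phi> (n - sgn n * int j)" "n - sgn n * int j \<noteq> 0"
      by (auto simp: sgn_if split: if_splits)
    then show "n \<in> ?\<phi> ` {i. i \<noteq> 0}" by blast
  qed
  then have "emeasure (measure_pmf p) {n. int j < \<bar>n\<bar>} \<le> emeasure (measure_pmf p) (?\<phi> ` {i. i \<noteq> 0})"
    by (intro emeasure_mono) auto
  also have "\<dots> = (\<integral>\<^sup>+i. ennreal (pmf p (?\<phi> i)) \<partial>count_space {i. i \<noteq> 0})"
    by (rule nn_integral_pmf'[OF inj, symmetric])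
  also have "\<dots> \<le> (\<integral>\<^sup>+i. ennreal g * ennreal (pmf p i) \<partial>count_space {i. i \<noteq> 0})"
    using decay \<open>0 \<le> g\<close> by (intro nn_integral_mono) (simp add: ennreal_mult[symmetric])
  also have "\<dots> = ennreal g * emeasure (measure_pmf p) {i. i \<noteq> 0}"
    by (simp add: nn_integral_cmult nn_integral_pmf)
  also have "\<dots> \<le> ennreal g * 1"
    by (intro mult_left_mono measure_pmf.subprob_emeasure_le_1) auto
  finally show ?thesis
    using \<open>0 \<le> g\<close> by (simp add: measure_pmf.emeasure_eq_measure)
qed

definition shifted :: "int pmf \<Rightarrow> int \<Rightarrow> int pmf" where
  "shifted p \<mu> = map_pmf (\<lambda>n. \<mu> + n) p"

lemma pmf_shifted: "pmf (shifted p \<mu>) n = pmf p (n - \<mu>)"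
  using pmf_map_inj'[of "\<lambda>n. \<mu> + n" p "n - \<mu>"] by (simp add: shifted_def inj_def)

lemma prob_shifted_tail:
  "measure_pmf.prob (shifted p \<mu>) {n. j < \<bar>n - \<mu>\<bar>} = measure_pmf.prob p {n. j < \<bar>n\<bar>}"
  by (simp add: shifted_def vimage_def)

section \<open>Discrete Laplace and Gaussian noise\<close>

text \<open>The parameter is the decay rate, the inverse of the usual scale: a larger
  \<open>b\<close> means less noise.\<close>

definition discrete_laplace :: "real \<Rightarrow> int pmf" where
  "discrete_laplace b = noise (\<lambda>n. exp (- (b * \<bar>real_of_int n\<bar>)))"

lemma pmf_discrete_laplace:
  assumes "0 < b"
  shows "\<exists>Z>0. \<forall>n. pmf (discrete_laplace b) n = exp (- (b * \<bar>real_of_int n\<bar>)) / Z"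
  unfolding discrete_laplace_def
  using pmf_noise[OF _ nn_integral_int_exp_finite[OF assms]] by simp

lemma pmf_discrete_laplace_pos: "0 < b \<Longrightarrow> 0 < pmf (discrete_laplace b) n"
  using pmf_discrete_laplace[of b] by auto

lemma pmf_discrete_laplace_shift:
  assumes "0 < b"
  shows "pmf (shifted (discrete_laplace b) \<mu>) n \<le>
    exp (b * real_of_int \<bar>\<mu> - \<nu>\<bar>) * pmf (shifted (discrete_laplace b) \<nu>) n"
proof -
  obtain Z where Z: "Z > 0" "\<And>n. pmf (discrete_laplace b) n = exp (- (b * \<bar>real_of_int n\<bar>)) / Z"
    using pmf_discrete_laplace[OF assms] by blast
  have "b * \<bar>real_of_int (n - \<nu>)\<bar> \<le> b * (real_of_int \<bar>\<mu> - \<nu>\<bar> + \<bar>real_of_int (n - \<mu>)\<bar>)"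
    using assms by (intro mult_left_mono) auto
  then have "exp (- (b * \<bar>real_of_int (n - \<mu>)\<bar>)) \<le>
      exp (b * real_of_int \<bar>\<mu> - \<nu>\<bar>) * exp (- (b * \<bar>real_of_int (n - \<nu>)\<bar>))"
    unfolding exp_add[symmetric] exp_le_cancel_iff by (simp add: algebra_simps)
  then show ?thesis
    using Z(1) by (simp add: pmf_shifted Z(2) divide_right_mono)
qed

lemma discrete_laplace_tail:
  assumes "0 < b"
  shows "measure_pmf.prob (shifted (discrete_laplace b) \<mu>) {n. int j < \<bar>n - \<mu>\<bar>} \<le> exp (- (b * real j))"
  unfolding prob_shifted_tail
proof (rule pmf_tail_le)
  fix i :: int assume "i \<noteq> 0"
  obtain Z where Z: "Z > 0" "\<And>n. pmf (discrete_laplace b) n = exp (- (b * \<bar>real_of_int n\<bar>)) / Z"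
    using pmf_discrete_laplace[OF assms] by blast
  have "\<bar>i + sgn i * int j\<bar> = \<bar>i\<bar> + int j"
    using \<open>i \<noteq> 0\<close> by (auto simp: sgn_if)
  then have eq: "\<bar>real_of_int (i + sgn i * int j)\<bar> = \<bar>real_of_int i\<bar> + real j"
    unfolding of_int_abs[symmetric] by simp
  show "pmf (discrete_laplace b) (i + sgn i * int j) \<le>
      exp (- (b * real j)) * pmf (discrete_laplace b) i"
    unfolding Z(2) eq by (simp add: distrib_left exp_diff exp_minus divide_inverse)
qed simp

text \<open>In the usual notation \<open>v\<close> is \<open>1 / (2 * sigma^2)\<close>.\<close>

definition discrete_gaussian :: "real \<Rightarrow> int pmf" where
  "discrete_gaussian v = noise (\<lambda>n. exp (- (v * (real_of_int n)\<^sup>2)))"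

lemma pmf_discrete_gaussian:
  assumes "0 < v"
  shows "\<exists>Z>0. \<forall>n. pmf (discrete_gaussian v) n = exp (- (v * (real_of_int n)\<^sup>2)) / Z"
  unfolding discrete_gaussian_def
proof (rule pmf_noise)
  have "\<bar>real_of_int n\<bar> \<le> (real_of_int n)\<^sup>2" for n
  proof -
    have "\<bar>n\<bar> * 1 \<le> \<bar>n\<bar> * \<bar>n\<bar>"
      by (cases "n = 0") (simp, intro mult_left_mono, auto)
    then have "\<bar>n\<bar> \<le> n\<^sup>2" by (simp add: power2_eq_square abs_mult_self_eq)
    then show ?thesis by (metis of_int_abs of_int_le_iff of_int_power)
  qed
  then have "(\<integral>\<^sup>+n. ennreal (exp (- (v * (real_of_int n)\<^sup>2))) \<partial>count_space UNIV) \<le>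
      (\<integral>\<^sup>+n. ennreal (exp (- (v * \<bar>real_of_int n\<bar>))) \<partial>count_space UNIV)"
    using assms by (intro nn_integral_mono ennreal_leI) simp
  also have "\<dots> < \<infinity>"
    by (rule nn_integral_int_exp_finite[OF assms])
  finally show "(\<integral>\<^sup>+n. ennreal (exp (- (v * (real_of_int n)\<^sup>2))) \<partial>count_space UNIV) < \<infinity>" .
qed simp

text \<open>Moving \<open>i\<close> away from 0 by \<open>j\<close> raises its square by at least
  \<open>j^2\<close>, the mixed term being nonnegative.\<close>

lemma discrete_gaussian_tail:
  assumes "0 < v"
  shows "measure_pmf.prob (shifted (discrete_gaussian v) \<mu>) {n. int j < \<bar>n - \<mu>\<bar>} \<le>
    exp (- (v * (real j)\<^sup>2))"
  unfolding prob_shifted_tail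
proof (rule pmf_tail_le)
  fix i :: int assume "i \<noteq> 0"
  obtain Z where Z: "Z > 0" "\<And>n. pmf (discrete_gaussian v) n = exp (- (v * (real_of_int n)\<^sup>2)) / Z"
    using pmf_discrete_gaussian[OF assms] by blast
  have "(i + sgn i * int j)\<^sup>2 \<ge> i\<^sup>2 + (int j)\<^sup>2"
  proof (cases "0 < i")
    case True
    then have "0 \<le> i * int j" by simp
    with True show ?thesis by (simp add: power2_sum)
  next
    case False
    then have "i * int j \<le> 0" by (simp add: mult_nonpos_nonneg)
    with False \<open>i \<noteq> 0\<close> show ?thesis by (simp add: power2_diff)
  qed
  then have "real_of_int (i\<^sup>2 + (int j)\<^sup>2) \<le> real_of_int ((i + sgn i * int j)\<^sup>2)"
    by (rule of_int_le_iff[THEN iffD2])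
  then have "(real_of_int i)\<^sup>2 + (real j)\<^sup>2 \<le> (real_of_int (i + sgn i * int j))\<^sup>2"
    unfolding of_int_add of_int_power of_int_of_nat_eq .
  then have "v * (real_of_int (i + sgn i * int j))\<^sup>2 \<ge> v * ((real_of_int i)\<^sup>2 + (real j)\<^sup>2)"
    using assms by (intro mult_left_mono) auto
  then have "exp (- (v * (real_of_int (i + sgn i * int j))\<^sup>2)) \<le>
      exp (- (v * (real j)\<^sup>2)) * exp (- (v * (real_of_int i)\<^sup>2))"
    unfolding exp_add[symmetric] exp_le_cancel_iff by (simp add: distrib_left)
  then show "pmf (discrete_gaussian v) (i + sgn i * int j) \<le>
      exp (- (v * (real j)\<^sup>2)) * pmf (discrete_gaussian v) i"
    using Z(1) unfolding Z(2) by (simp add: divide_right_mono)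
qed simp

text \<open>Completing the square turns the integrand into a constant times the same noise centred
  at \<open>\<mu> - n * (\<nu> - \<mu>)\<close>. This centre is again an integer, so the total mass
  is exactly 1 and the formula is an equality.\<close>

lemma discrete_gaussian_moment:
  assumes "0 < v"
  shows "(\<integral>\<^sup>+a. ennreal ((pmf (shifted (discrete_gaussian v) \<mu>) a /
                     pmf (shifted (discrete_gaussian v) \<nu>) a) ^ n)
            \<partial>shifted (discrete_gaussian v) \<mu>) =
         ennreal (exp (v * real n * (real n + 1) * (real_of_int (\<mu> - \<nu>))\<^sup>2))"
proof -
  let ?p = "discrete_gaussian v" and ?c = "exp (v * real n * (real n + 1) * (real_of_int (\<mu> - \<nu>))\<^sup>2)"
  obtain Z where Z: "Z > 0" "\<And>n. pmf ?p n = exp (- (v * (real_of_int n)\<^sup>2)) / Z"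
    using pmf_discrete_gaussian[OF assms] by blast
  have complete_square: "pmf ?p (a - \<mu>) * (pmf ?p (a - \<mu>) / pmf ?p (a - \<nu>)) ^ n =
      ?c * pmf ?p (a - (\<mu> - int n * (\<nu> - \<mu>)))" for a
  proof -
    define u s where "u = real_of_int (a - \<mu>)" and "s = real_of_int (\<nu> - \<mu>)"
    have u: "real_of_int (a - \<nu>) = u - s" "real_of_int (a - (\<mu> - int n * (\<nu> - \<mu>))) = u + real n * s"
      "real_of_int (\<mu> - \<nu>) = - s"
      by (simp_all add: u_def s_def)
    have "exp (- (v * u\<^sup>2)) * (exp (- (v * u\<^sup>2)) / exp (- (v * (u - s)\<^sup>2))) ^ n =
        exp (- (v * u\<^sup>2) + real n * (- (v * u\<^sup>2) + v * (u - s)\<^sup>2))"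
      by (simp add: exp_diff[symmetric] exp_of_nat_mult[symmetric] exp_add[symmetric])
    also have "- (v * u\<^sup>2) + real n * (- (v * u\<^sup>2) + v * (u - s)\<^sup>2) =
        v * real n * (real n + 1) * (- s)\<^sup>2 + - (v * (u + real n * s)\<^sup>2)"
      by algebra
    finally show ?thesis
      using Z(1) unfolding Z(2) u u_def[symmetric] exp_add by simp
  qed
  have "(\<integral>\<^sup>+a. ennreal ((pmf (shifted ?p \<mu>) a / pmf (shifted ?p \<nu>) a) ^ n) \<partial>shifted ?p \<mu>) =
    (\<integral>\<^sup>+a. ennreal ?c * ennreal (pmf (shifted ?p (\<mu> - int n * (\<nu> - \<mu>))) a) \<partial>count_space UNIV)"
    unfolding nn_integral_measure_pmf
    by (intro nn_integral_cong) (simp add: pmf_shifted complete_square flip: ennreal_mult)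
  then show ?thesis
    by (simp add: nn_integral_cmult nn_integral_pmf)
qed

section \<open>Renyi divergence of distributions with bounded ratio\<close>

text \<open>The function \<open>exp (- t^2 / 2) * cosh t\<close> decreases for nonnegative
  \<open>t\<close>, because \<open>sinh t \<le> t * cosh t\<close>.\<close>

lemma cosh_le_exp_half_square: "cosh z \<le> exp (z\<^sup>2 / 2)" for z :: real
proof -
  have sinh_le: "sinh y \<le> y * cosh y" if "0 \<le> y" for y :: real
  proof -
    have "0 * cosh 0 - sinh 0 \<le> y * cosh y - sinh y"
    proof (rule DERIV_nonneg_imp_nondecreasing[OF that, where f = "\<lambda>t. t * cosh t - sinh t"])
      fix t :: real assume "0 \<le> t"
      then show "\<exists>d. ((\<lambda>t. t * cosh t - sinh t) has_real_derivative d) (at t) \<and> 0 \<le> d"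
        by (intro exI[of _ "t * sinh t"]) (auto intro!: derivative_eq_intros)
    qed
    then show ?thesis by simp
  qed
  have "exp (- (\<bar>z\<bar>\<^sup>2 / 2)) * cosh \<bar>z\<bar> \<le> exp (- (0\<^sup>2 / 2)) * cosh 0"
  proof (rule DERIV_nonpos_imp_nonincreasing[where f = "\<lambda>t. exp (- (t\<^sup>2 / 2)) * cosh t"])
    fix t :: real assume "0 \<le> t"
    then have "exp (- (t\<^sup>2 / 2)) * (sinh t - t * cosh t) \<le> 0"
      using sinh_le[of t] by (intro mult_nonneg_nonpos) auto
    then show "\<exists>d. ((\<lambda>t. exp (- (t\<^sup>2 / 2)) * cosh t) has_real_derivative d) (at t) \<and> d \<le> 0"
      by (intro exI[of _ "exp (- (t\<^sup>2 / 2)) * (sinh t - t * cosh t)"])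
         (auto intro!: derivative_eq_intros simp: algebra_simps)
  qed simp
  then show ?thesis
    by (simp add: exp_minus field_simps)
qed

text \<open>
  The right-hand side is the chord of \<open>r\<^sup>n\<^sup>+\<^sup>1\<close> over \<open>[exp (- C), exp C]\<close>, written
  in terms of \<open>u n = sinh (n C) / sinh C\<close>, which satisfies a Chebyshev recursion.
\<close>

lemma power_le_chord:
  fixes C r :: real
  assumes "0 < C" "exp (- C) \<le> r" "r \<le> exp C"
  shows "r ^ Suc n \<le> sinh (real (Suc n) * C) / sinh C * r - sinh (real n * C) / sinh C"
proof (induction n)
  case 0
  then show ?case using assms by simp
next
  case (Suc n)
  define u where "u = (\<lambda>n. sinh (real n * C) / sinh C)"
  have "0 < sinh C" using assms by simp
  have "0 < r" using assms(2) exp_gt_zero less_le_trans by blast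
  \<comment> \<open>\<open>r\<close> lies between the roots of
    \<open>r^2 - 2 * cosh C * r + 1\<close>. This linear bound on \<open>r^2\<close> removes the
    square that appears when the induction hypothesis is multiplied by \<open>r\<close>.\<close>
  have "(r - exp C) * (r - exp (- C)) \<le> 0"
    using assms by (intro mult_nonpos_nonneg) auto
  then have square: "r\<^sup>2 \<le> 2 * cosh C * r - 1"
    by (simp add: cosh_def algebra_simps power2_eq_square exp_minus_inverse)
  have "sinh (real (Suc (Suc n)) * C) + sinh (real n * C) = 2 * cosh C * sinh (real (Suc n) * C)"
  proof -
    have "real (Suc (Suc n)) * C = real (Suc n) * C + C" "real n * C = real (Suc n) * C - C"
      by (simp_all add: algebra_simps)
    then show ?thesis by (simp only: sinh_add sinh_diff) simp
  qed
  then have rec: "u (Suc (Suc n)) = 2 * cosh C * u (Suc n) - u n"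
    using \<open>0 < sinh C\<close> by (simp add: u_def field_simps del: of_nat_Suc)
  have "0 \<le> u (Suc n)"
    using assms by (simp add: u_def)
  have "r ^ Suc (Suc n) \<le> (u (Suc n) * r - u n) * r"
    using Suc.IH \<open>0 < r\<close> unfolding u_def
    by (subst power_Suc2) (intro mult_right_mono, auto)
  also have "\<dots> = u (Suc n) * r\<^sup>2 - u n * r"
    by (simp add: algebra_simps power2_eq_square)
  also have "\<dots> \<le> u (Suc n) * (2 * cosh C * r - 1) - u n * r"
    using square \<open>0 \<le> u (Suc n)\<close> by (intro diff_right_mono mult_left_mono)
  also have "\<dots> = u (Suc (Suc n)) * r - u (Suc n)"
    by (simp add: rec algebra_simps)
  finally show ?case by (simp add: u_def)
qed

text \<open>\<open>b - a\<close> is the value of the chord at \<open>r = 1\<close>, hence at least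
  1. It equals \<open>cosh ((n + 1/2) * C) / cosh (C / 2)\<close>, and dropping the denominator
  gives the bound quadratic in \<open>C\<close>.\<close>

lemma chord_bound:
  assumes "0 < (C::real)"
  obtains a b where "0 \<le> a" "0 \<le> b" "1 \<le> b - a" "b - a \<le> exp ((real n + 1/2)\<^sup>2 * C\<^sup>2 / 2)"
    "\<And>r. exp (- C) \<le> r \<Longrightarrow> r \<le> exp C \<Longrightarrow> r ^ Suc n + a \<le> b * r"
proof
  let ?b = "sinh (real (Suc n) * C) / sinh C" and ?a = "sinh (real n * C) / sinh C"
  show "r ^ Suc n + ?a \<le> ?b * r" if "exp (- C) \<le> r" "r \<le> exp C" for r
    using power_le_chord[OF assms that, of n] by linarith
  show "0 \<le> ?a" "0 \<le> ?b"
    using assms by simp_all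
  show "1 \<le> ?b - ?a"
    using power_le_chord[OF assms, of 1 n] assms by simp
  define z w where "z = (real n + 1/2) * C" and "w = C / 2"
  have zw: "real (Suc n) * C = z + w" "real n * C = z - w" "C = w + w"
    by (simp_all add: z_def w_def algebra_simps)
  have "0 < sinh w" using assms by (simp add: w_def)
  have "?b - ?a = (sinh (z + w) - sinh (z - w)) / sinh (w + w)"
    unfolding zw[symmetric] by (simp add: diff_divide_distrib)
  also have "\<dots> = cosh z / cosh w"
    using \<open>0 < sinh w\<close> cosh_real_pos[of w] unfolding sinh_add sinh_diff
    by (simp add: divide_eq_eq)
  also have "\<dots> \<le> cosh z"
    using cosh_real_ge_1[of w] cosh_real_ge_1[of z] by (simp add: divide_le_eq mult_le_cancel_left1)
  also have "\<dots> \<le> exp (z\<^sup>2 / 2)"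
    by (rule cosh_le_exp_half_square)
  finally show "?b - ?a \<le> exp ((real n + 1/2)\<^sup>2 * C\<^sup>2 / 2)"
    by (simp add: z_def power_mult_distrib)
qed

lemma nn_integral_pmf_ratio:
  assumes "\<And>v. 0 < pmf p v"
  shows "(\<integral>\<^sup>+v. ennreal (pmf q v / pmf p v) \<partial>p) = 1"
proof -
  have "pmf p v * (pmf q v / pmf p v) = pmf q v" for v
    using assms[of v] by simp
  then have "(\<integral>\<^sup>+v. ennreal (pmf q v / pmf p v) \<partial>p) = (\<integral>\<^sup>+v. ennreal (pmf q v) \<partial>count_space UNIV)"
    unfolding nn_integral_measure_pmf by (simp add: ennreal_mult[symmetric])
  then show ?thesis by (simp add: nn_integral_pmf)
qed

text \<open>Divide the chord bound by the ratio: what remains is the \<open>n\<close>-th power plus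
  a multiple of \<open>q / p\<close>, whose mean under \<open>p\<close> is 1. The term
  \<open>a / s\<close> stays on the left until the integral is known to be finite.\<close>

lemma nn_integral_ratio_power_le:
  assumes pos: "\<And>v. 0 < pmf p v" "\<And>v. 0 < pmf q v" and "0 < s" "0 \<le> a" "0 \<le> b"
    and chord: "\<And>v. (s * (pmf p v / pmf q v)) ^ Suc n + a \<le> b * (s * (pmf p v / pmf q v))"
  shows "(\<integral>\<^sup>+v. ennreal ((s * (pmf p v / pmf q v)) ^ n) \<partial>p) \<le> ennreal (b - a / s)"
    and "0 \<le> b - a / s"
proof -
  let ?r = "\<lambda>v. s * (pmf p v / pmf q v)"
  have r: "0 < ?r v" for v using pos \<open>0 < s\<close> by simp
  have le: "?r v ^ n + a / s * (pmf q v / pmf p v) \<le> b" for v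
  proof -
    have "(?r v ^ Suc n + a) / ?r v \<le> b * ?r v / ?r v"
      using chord r[of v] by (intro divide_right_mono) auto
    moreover have "(?r v ^ Suc n + a) / ?r v = ?r v ^ n + a / s * (pmf q v / pmf p v)"
      using r[of v] pos[of v] \<open>0 < s\<close> by (simp add: field_simps)
    moreover have "b * ?r v / ?r v = b"
      using r[of v] by (intro nonzero_mult_div_cancel_right) auto
    ultimately show ?thesis by argo
  qed
  have "(\<integral>\<^sup>+v. ennreal (a / s * (pmf q v / pmf p v)) \<partial>p) =
      (\<integral>\<^sup>+v. ennreal (a / s) * ennreal (pmf q v / pmf p v) \<partial>p)"
    using \<open>0 \<le> a\<close> \<open>0 < s\<close> by (intro nn_integral_cong ennreal_mult) auto
  then have ratio: "(\<integral>\<^sup>+v. ennreal (a / s * (pmf q v / pmf p v)) \<partial>p) = ennreal (a / s)"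
    using pos by (simp only: nn_integral_cmult nn_integral_pmf_ratio) (simp add: nn_integral_cmult nn_integral_pmf_ratio)
  have "(\<integral>\<^sup>+v. ennreal (?r v ^ n) \<partial>p) + ennreal (a / s) =
      (\<integral>\<^sup>+v. ennreal (?r v ^ n) \<partial>p) + (\<integral>\<^sup>+v. ennreal (a / s * (pmf q v / pmf p v)) \<partial>p)"
    using ratio by simp
  also have "\<dots> = (\<integral>\<^sup>+v. ennreal (?r v ^ n + a / s * (pmf q v / pmf p v)) \<partial>p)"
    using \<open>0 \<le> a\<close> \<open>0 < s\<close> r
    by (subst nn_integral_add[symmetric]) (auto intro!: nn_integral_cong simp: ennreal_plus less_imp_le)
  also have "\<dots> \<le> (\<integral>\<^sup>+v. ennreal b \<partial>p)"
    using le by (intro nn_integral_mono ennreal_leI)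
  finally have *: "(\<integral>\<^sup>+v. ennreal (?r v ^ n) \<partial>p) + ennreal (a / s) \<le> ennreal b"
    by simp
  obtain i where i: "0 \<le> i" "(\<integral>\<^sup>+v. ennreal (?r v ^ n) \<partial>p) = ennreal i"
    using * by (cases "\<integral>\<^sup>+v. ennreal (?r v ^ n) \<partial>p") (auto simp: top_unique)
  have "i + a / s \<le> b"
    using * i \<open>0 \<le> a\<close> \<open>0 < s\<close> \<open>0 \<le> b\<close> by (simp flip: ennreal_plus)
  then show "(\<integral>\<^sup>+v. ennreal (?r v ^ n) \<partial>p) \<le> ennreal (b - a / s)" "0 \<le> b - a / s"
    unfolding i(2) using i(1) by (auto intro: ennreal_leI)
qed

section \<open>Lazy updates: privacy\<close>

text \<open>The index 0 before any update makes the initial published value \<open>Q []\<close>,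
  which is the same for all streams and reveals nothing.\<close>

primrec level :: "int option list \<Rightarrow> int" where
  "level [] = 0"
| "level (a # h) = (case a of None \<Rightarrow> level h | Some v \<Rightarrow> v)"

primrec updates :: "int option list \<Rightarrow> nat" where
  "updates [] = 0"
| "updates (a # h) = (case a of None \<Rightarrow> updates h | Some v \<Rightarrow> Suc (updates h))"

lemma updates_le_length: "updates h \<le> length h"
  by (induction h) (auto split: option.split)

text \<open>
  After \<open>k\<close> updates the weight vanishes, which freezes the published value. Otherwise a step
  updates with probability \<open>w / (1 + H + w)\<close>, where \<open>H\<close> (called \<open>mass\<close>) is the total weight of the
  steps since the last update. The fresh value is a multiple of \<open>1 / m\<close>, shifted by \<open>Q []\<close>.
\<close>

locale lazy_updates =
  fixes Q :: "stream \<Rightarrow> real" and c \<tau> :: real and m k :: nat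
  assumes c_pos: "0 < c" and m_pos: "0 < m"
begin

definition published :: "int option list \<Rightarrow> real" where
  "published h = Q [] + real_of_int (level h) / real m"

definition weight :: "stream \<Rightarrow> int option list \<Rightarrow> real" where
  "weight p h = (if updates h < k then exp (c * (\<bar>Q p - published h\<bar> - \<tau>)) else 0)"

primrec mass :: "stream \<Rightarrow> int option list \<Rightarrow> real" where
  "mass x [] = 0"
| "mass x (a # h) =
     (case a of None \<Rightarrow> mass x h + weight (take (Suc (length h)) x) h | Some v \<Rightarrow> 0)"

definition fresh :: "stream \<Rightarrow> int pmf" where
  "fresh p = shifted (discrete_laplace (c / real m)) \<lfloor>real m * (Q p - Q [])\<rfloor>"

definition kernel :: "stream \<Rightarrow> int option list \<Rightarrow> int option pmf" where
  "kernel p h =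
     bind_pmf (bernoulli_pmf (weight p h / (1 + mass p h + weight p h)))
       (\<lambda>b. if b then map_pmf Some (fresh p) else return_pmf None)"

lemma weight_nonneg: "0 \<le> weight p h"
  by (simp add: weight_def)

lemma mass_nonneg: "0 \<le> mass x h"
  by (induction h) (auto split: option.split simp: weight_nonneg add_nonneg_nonneg)

text \<open>The kernel sees only a prefix while the analysis speaks of the whole stream; a history
  never refers to updates beyond its own length.\<close>

lemma mass_take: "length h \<le> n \<Longrightarrow> mass (take n x) h = mass x h"
  by (induction h) (auto split: option.split simp: min_def)

lemma nn_integral_kernel:
  "(\<integral>\<^sup>+a. f a \<partial>kernel p h) =
     (\<integral>\<^sup>+v. f (Some v) \<partial>fresh p) * ennreal (weight p h / (1 + mass p h + weight p h)) +
     f None * ennreal ((1 + mass p h) / (1 + mass p h + weight p h))"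
proof -
  have "1 - weight p h / (1 + mass p h + weight p h) = (1 + mass p h) / (1 + mass p h + weight p h)"
    using weight_nonneg[of p h] mass_nonneg[of p h] by (simp add: field_simps)
  then show ?thesis
    using weight_nonneg[of p h] mass_nonneg[of p h] by (simp add: kernel_def divide_le_eq_1)
qed

lemma pmf_kernel_None: "pmf (kernel p h) None = (1 + mass p h) / (1 + mass p h + weight p h)"
proof -
  have "ennreal (pmf (kernel p h) None) = ennreal ((1 + mass p h) / (1 + mass p h + weight p h))"
    using nn_integral_kernel[where f = "indicator {None}" and p = p and h = h]
    by (simp add: emeasure_pmf_single)
  then show ?thesis
    using weight_nonneg[of p h] mass_nonneg[of p h] by simp
qed

lemma pmf_kernel_Some:
  "pmf (kernel p h) (Some v) = weight p h / (1 + mass p h + weight p h) * pmf (fresh p) v"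
proof -
  have "(\<integral>\<^sup>+v'. indicator {Some v} (Some v') \<partial>fresh p) = ennreal (pmf (fresh p) v)"
    using nn_integral_indicator[of "{v}" "measure_pmf (fresh p)"]
    by (simp add: indicator_def emeasure_pmf_single)
  then have "ennreal (pmf (kernel p h) (Some v)) =
      ennreal (weight p h / (1 + mass p h + weight p h) * pmf (fresh p) v)"
    using nn_integral_kernel[where f = "indicator {Some v}" and p = p and h = h]
      weight_nonneg[of p h] mass_nonneg[of p h]
    by (subst ennreal_mult) (auto simp: emeasure_pmf_single mult.commute)
  then show ?thesis
    using weight_nonneg[of p h] mass_nonneg[of p h] by simp
qed

lemma pmf_fresh_pos: "0 < pmf (fresh p) v"
  using c_pos m_pos by (simp add: fresh_def pmf_shifted pmf_discrete_laplace_pos)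

text \<open>After \<open>k\<close> updates the weight is 0, so a further update has probability
  0.\<close>

lemma updates_le:
  "pmf (run kernel x (length h)) h \<noteq> 0 \<Longrightarrow> updates h \<le> k"
proof (induction h)
  case (Cons a h)
  then show ?case
    by (cases a) (auto simp: pmf_run_Cons pmf_kernel_Some weight_def simp del: run.simps split: if_splits)
qed simp

section \<open>Pure privacy of lazy updates\<close>

text \<open>This is all that the privacy proofs for lazy updates need to know about neighbouring
  streams.\<close>

definition near :: "nat \<Rightarrow> stream \<Rightarrow> stream \<Rightarrow> bool" where
  "near T x y \<longleftrightarrow> (\<forall>t\<in>{1..T}. \<bar>Q (take t x) - Q (take t y)\<bar> \<le> 1)"

lemma near_sym: "near T x y \<Longrightarrow> near T y x"
  by (auto simp: near_def abs_minus_commute)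

lemma weight_near:
  assumes near: "near T x y" and "length h < T"
  shows "weight (take (Suc (length h)) x) h \<le> exp c * weight (take (Suc (length h)) y) h"
proof (cases "updates h < k")
  case True
  have "\<bar>Q (take (Suc (length h)) x) - Q (take (Suc (length h)) y)\<bar> \<le> 1"
    using assms by (simp add: near_def)
  then have "\<bar>Q (take (Suc (length h)) x) - published h\<bar> - \<tau> \<le>
      1 + (\<bar>Q (take (Suc (length h)) y) - published h\<bar> - \<tau>)"
    by linarith
  then have "c * (\<bar>Q (take (Suc (length h)) x) - published h\<bar> - \<tau>) \<le>
      c * (1 + (\<bar>Q (take (Suc (length h)) y) - published h\<bar> - \<tau>))"
    using c_pos by (intro mult_left_mono) auto
  then show ?thesis
    using True by (simp add: weight_def distrib_left flip: exp_add)
qed (simp add: weight_def)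

text \<open>The mass is a sum of weights, each within a factor \<open>exp c\<close>, and an update
  resets it to 0 on both sides.\<close>

lemma mass_near:
  "near T x y \<Longrightarrow> length h \<le> T \<Longrightarrow> 1 + mass x h \<le> exp c * (1 + mass y h)"
proof (induction h)
  case (Cons a h)
  then show ?case
    using weight_near[of T x y h] c_pos by (cases a) (auto simp: distrib_left)
qed (use c_pos in simp)

text \<open>The grid has an integer number \<open>m\<close> of points per unit, so values at
  distance at most 1 have floors at most \<open>m\<close> apart: rounding does not increase the
  sensitivity.\<close>

lemma fresh_near:
  assumes "near T x y" "t \<in> {1..T}"
  shows "pmf (fresh (take t x)) v \<le> exp c * pmf (fresh (take t y)) v"
proof -
  let ?a = "real m * (Q (take t x) - Q [])" and ?b = "real m * (Q (take t y) - Q [])"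
  have "\<bar>?a - ?b\<bar> = real m * \<bar>Q (take t x) - Q (take t y)\<bar>"
    by (simp add: abs_mult flip: right_diff_distrib)
  also have "\<dots> \<le> real m * 1"
    using assms by (intro mult_left_mono) (auto simp: near_def)
  finally have "?a \<le> ?b + real m" "?b \<le> ?a + real m" by linarith+
  then have "\<bar>\<lfloor>?a\<rfloor> - \<lfloor>?b\<rfloor>\<bar> \<le> int m"
    using floor_mono[of ?a "?b + of_int (int m)"] floor_mono[of ?b "?a + of_int (int m)"] by simp
  then have "real_of_int \<bar>\<lfloor>?a\<rfloor> - \<lfloor>?b\<rfloor>\<bar> \<le> real m"
    by linarith
  then have "c / real m * real_of_int \<bar>\<lfloor>?a\<rfloor> - \<lfloor>?b\<rfloor>\<bar> \<le> c / real m * real m"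
    using c_pos by (intro mult_left_mono) auto
  then have "exp (c / real m * real_of_int \<bar>\<lfloor>?a\<rfloor> - \<lfloor>?b\<rfloor>\<bar>) * pmf (fresh (take t y)) v \<le>
      exp c * pmf (fresh (take t y)) v"
    using m_pos by (intro mult_right_mono) auto
  with pmf_discrete_laplace_shift[of "c / real m" "\<lfloor>?a\<rfloor>" v "\<lfloor>?b\<rfloor>"] c_pos m_pos
  show ?thesis
    unfolding fresh_def by simp
qed

text \<open>
  The factors \<open>(1 + H) / (1 + H + w)\<close> of the steps without update telescope, so that a phase ended
  by the update to \<open>v\<close> contributes only this factor to the probability of a history.
\<close>

definition update_density :: "stream \<Rightarrow> int option list \<Rightarrow> int \<Rightarrow> real" where
  "update_density x h v =
     weight (take (Suc (length h)) x) h * pmf (fresh (take (Suc (length h)) x)) v /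
       ((1 + mass x h) * (1 + mass x (None # h)))"

lemma update_density_nonneg: "0 \<le> update_density x h v"
  unfolding update_density_def
  by (intro divide_nonneg_nonneg mult_nonneg_nonneg add_nonneg_nonneg weight_nonneg mass_nonneg
      pmf_nonneg zero_le_one)

text \<open>Four factors \<open>exp c\<close>: one for the weight, one for the noise, and one for
  each of the two masses in the denominator.\<close>

lemma update_density_near:
  assumes near: "near T x y" and h: "length h < T"
  shows "update_density x h v \<le> exp (4 * c) * update_density y h v"
proof -
  let ?t = "Suc (length h)"
  have t: "?t \<in> {1..T}" using h by simp
  have double: "exp (2 * c) = exp c * exp c" by (simp add: mult_exp_exp)
  define Ax Ay where "Ax = weight (take ?t x) h * pmf (fresh (take ?t x)) v"
    and "Ay = weight (take ?t y) h * pmf (fresh (take ?t y)) v"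
  define Dx Dy where "Dx = (1 + mass x h) * (1 + mass x (None # h))"
    and "Dy = (1 + mass y h) * (1 + mass y (None # h))"
  have pos: "0 < Dx" "0 < Dy" "0 \<le> Ay"
    unfolding Dx_def Dy_def Ay_def
    by (intro mult_pos_pos add_pos_nonneg mult_nonneg_nonneg mass_nonneg weight_nonneg; simp)+
  have "Ax \<le> (exp c * weight (take ?t y) h) * (exp c * pmf (fresh (take ?t y)) v)"
    unfolding Ax_def using weight_near[OF near h] fresh_near[OF near t, of v]
    by (intro mult_mono) (auto intro: mult_nonneg_nonneg weight_nonneg)
  then have A: "Ax \<le> exp (2 * c) * Ay"
    unfolding Ay_def double by (simp only: mult_ac)
  have "Dy \<le> (exp c * (1 + mass x h)) * (exp c * (1 + mass x (None # h)))"
    unfolding Dy_def using h mass_near[OF near_sym[OF near], of h]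
      mass_near[OF near_sym[OF near], of "None # h"] mass_nonneg[of y "None # h"] mass_nonneg[of x h]
    by (intro mult_mono) (auto simp del: mass.simps)
  then have D: "Dy \<le> exp (2 * c) * Dx"
    unfolding Dx_def double by (simp only: mult_ac)
  have "Ax / Dx \<le> exp (2 * c) * Ay / Dx"
    using A pos by (intro divide_right_mono) auto
  also have "\<dots> = exp (2 * c) * Ay * (1 / Dx)" by simp
  also have "\<dots> \<le> exp (2 * c) * Ay * (exp (2 * c) / Dy)"
    using D pos by (intro mult_left_mono) (auto simp: field_simps)
  also have "\<dots> = exp (4 * c) * (Ay / Dy)"
    using exp_add[of "2 * c" "2 * c"] by simp
  finally show ?thesis
    by (simp add: update_density_def Ax_def Ay_def Dx_def Dy_def del: mass.simps)
qed

text \<open>The telescoping itself: probability times \<open>1 + mass\<close> is invariant under a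
  step without update.\<close>

lemma pmf_run_None:
  "pmf (run kernel x (Suc (length h))) (None # h) * (1 + mass x (None # h)) =
     pmf (run kernel x (length h)) h * (1 + mass x h)"
  using mass_nonneg[of x "None # h"]
  by (simp add: pmf_run_Cons pmf_kernel_None mass_take add.assoc del: run.simps)

lemma pmf_run_Some:
  "pmf (run kernel x (Suc (length h))) (Some v # h) =
     pmf (run kernel x (length h)) h * (1 + mass x h) * update_density x h v"
  using mass_nonneg[of x h]
  by (simp add: pmf_run_Cons pmf_kernel_Some update_density_def mass_take add.assoc del: run.simps)

text \<open>The compared products change only at updates, so the loss depends on the number of
  updates and not on the number of steps.\<close>

lemma pmf_run_near:
  assumes near: "near T x y"
  shows "length h \<le> T \<Longrightarrow> pmf (run kernel x (length h)) h * (1 + mass x h) \<le>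
    exp (4 * c * real (updates h)) * (pmf (run kernel y (length h)) h * (1 + mass y h))"
proof (induction h)
  case (Cons a h)
  show ?case
  proof (cases a)
    case None
    then show ?thesis
      using Cons pmf_run_None[of x h] pmf_run_None[of y h] by (simp del: run.simps mass.simps)
  next
    case (Some v)
    have "(pmf (run kernel x (length h)) h * (1 + mass x h)) * update_density x h v \<le>
        (exp (4 * c * real (updates h)) * (pmf (run kernel y (length h)) h * (1 + mass y h))) *
        (exp (4 * c) * update_density y h v)"
    proof (rule mult_mono)
      show "update_density x h v \<le> exp (4 * c) * update_density y h v"
        using Cons.prems by (intro update_density_near[OF near]) simp
    qed (use Cons mass_nonneg[of y h] update_density_nonneg[of x h v] in auto)
    then show ?thesis
      using Some by (simp add: pmf_run_Some distrib_left exp_add mult_ac del: run.simps)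
  qed
qed simp

text \<open>Each of at most \<open>k\<close> updates costs \<open>4 * c\<close>; the last
  \<open>c\<close> pays for removing the factor \<open>1 + mass\<close> of the unfinished
  phase.\<close>

lemma pure_privacy:
  assumes near: "near T x y"
  shows "measure_pmf.prob (run kernel x T) E \<le>
    exp ((4 * real k + 1) * c) * measure_pmf.prob (run kernel y T) E"
proof -
  have exp: "exp ((4 * real k + 1) * c) = exp (4 * c * real k) * exp c"
    by (simp add: mult_exp_exp algebra_simps)
  have le: "pmf (run kernel x T) h \<le> exp ((4 * real k + 1) * c) * pmf (run kernel y T) h" for h
  proof (cases "pmf (run kernel x T) h = 0")
    case False
    then have T: "T = length h"
      using length_run[of h kernel x T] by (simp add: set_pmf_iff)
    let ?X = "1 + mass x h" and ?Y = "1 + mass y h"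
    have X: "0 < ?X" and Y: "0 \<le> ?Y" using mass_nonneg[of x h] mass_nonneg[of y h] by auto
    have "4 * c * real (updates h) \<le> 4 * c * real k"
      using updates_le[of x h] False T c_pos by auto
    then have "exp (4 * c * real (updates h)) * (pmf (run kernel y T) h * ?Y) \<le>
        exp (4 * c * real k) * (pmf (run kernel y T) h * (exp c * ?X))"
      using Y mass_near[OF near_sym[OF near], of h] T
      by (intro mult_mono) auto
    moreover have "pmf (run kernel x T) h * ?X \<le>
        exp (4 * c * real (updates h)) * (pmf (run kernel y T) h * ?Y)"
      using pmf_run_near[OF near, of h] T by simp
    ultimately have "pmf (run kernel x T) h * ?X \<le>
        exp (4 * c * real k) * (pmf (run kernel y T) h * (exp c * ?X))"
      by linarith
    then have "pmf (run kernel x T) h * ?X \<le>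
        (exp ((4 * real k + 1) * c) * pmf (run kernel y T) h) * ?X"
      unfolding exp by (simp only: mult_ac)
    then show ?thesis using X by simp
  qed simp
  then show ?thesis
    using prob_le_of_pmf_le[of "run kernel x T" "exp ((4 * real k + 1) * c)" "run kernel y T"
        "\<lambda>_. 0" 0 E] by simp
qed

end

section \<open>Approximate privacy of lazy updates\<close>

text \<open>One step of the moment argument, as an exact identity. Since
  \<open>w / (X * (X + w))\<close> is \<open>1 / X - 1 / (X + w)\<close>, the linear chord
  expression for the current phase splits into the share of an update now and the share of all later
  updates.\<close>

lemma potential_split:
  fixes X Y w w' :: real
  assumes pos: "0 < X" "0 < Y" "0 < w" "0 < w'"
    and s: "s = (w / (X * (X + w))) / (w' / (Y * (Y + w')))"
  shows "(X / Y) ^ n * (b - a / s) * (w / (X + w)) +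
      ((X / (X + w)) / (Y / (Y + w'))) ^ n *
        ((X + w) ^ Suc n / (Y + w') ^ n * (b / (X + w) - a / (Y + w'))) * (X / (X + w)) =
    X ^ Suc n / Y ^ n * (b / X - a / Y)"
proof -
  define X1 Y1 where "X1 = X + w" and "Y1 = Y + w'"
  have pos1: "0 < X1" "0 < Y1" using pos by (auto simp: X1_def Y1_def)
  define u u' where "u = w / (X * X1)" and "u' = w' / (Y * Y1)"
  have "0 < u" "0 < u'"
    using pos pos1 by (simp_all add: u_def u'_def)
  moreover have "u = 1 / X - 1 / X1" "u' = 1 / Y - 1 / Y1"
    using pos pos1 by (auto simp: u_def u'_def X1_def Y1_def field_simps)
  ultimately have u: "u = 1 / X - 1 / X1" "u' = 1 / Y - 1 / Y1" "0 < u" "0 < u'" by auto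
  have "(b - a / s) * u = b * u - a * u'"
    using u unfolding s X1_def[symmetric] Y1_def[symmetric] u_def[symmetric] u'_def[symmetric]
    by (simp add: field_simps)
  moreover have "w / X1 = X * u"
    using pos by (simp add: u_def)
  ultimately have first: "(X / Y) ^ n * (b - a / s) * (w / X1) = X ^ Suc n / Y ^ n * (b * u - a * u')"
    using pos by (simp add: power_divide mult_ac)
  have "((X / X1) / (Y / Y1)) ^ n * (X1 ^ Suc n / Y1 ^ n) * (X / X1) = X ^ Suc n / Y ^ n"
    using pos pos1 by (simp add: power_divide power_mult_distrib)
  then have second: "((X / X1) / (Y / Y1)) ^ n * (X1 ^ Suc n / Y1 ^ n * (b / X1 - a / Y1)) * (X / X1) =
      X ^ Suc n / Y ^ n * (b / X1 - a / Y1)"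
    by (metis mult.assoc mult.commute)
  have "b * u - a * u' + (b / X1 - a / Y1) = b / X - a / Y"
    by (simp add: u(1,2) algebra_simps)
  then show ?thesis
    unfolding X1_def[symmetric] Y1_def[symmetric] first second distrib_left[symmetric] by simp
qed

lemma ennreal_distrib:
  assumes "0 \<le> e" "0 \<le> u" "0 \<le> v" "0 \<le> z"
  shows "ennreal (e * u) * ennreal v + ennreal (e * z) = ennreal (e * (u * v + z))"
  using assms by (simp add: distrib_left mult.assoc flip: ennreal_mult ennreal_plus)

context lazy_updates
begin

text \<open>The phases are composed by a potential with one factor \<open>b - a\<close> per phase,
  for \<open>C = 4 * c\<close>. The budget says that \<open>k + 1\<close> such factors are at most
  \<open>exp (n * \<epsilon>) * \<delta>\<close>.\<close>

lemma approx_privacy: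
  assumes near: "near T x y" and "0 < \<delta>"
    and budget: "(real k + 1) * ((real n + 1/2)\<^sup>2 * (4 * c)\<^sup>2 / 2) \<le> real n * \<epsilon> + ln \<delta>"
  shows "measure_pmf.prob (run kernel x T) E \<le>
    exp \<epsilon> * measure_pmf.prob (run kernel y T) E + \<delta>"
proof (rule approx_dp_of_moment)
  fix h assume 0: "pmf (run kernel y T) h = 0"
  show "pmf (run kernel x T) h = 0"
  proof (rule ccontr)
    assume nz: "pmf (run kernel x T) h \<noteq> 0"
    then have "T = length h"
      using length_run[of h kernel x T] by (simp add: set_pmf_iff)
    then have "pmf (run kernel x T) h * (1 + mass x h) \<le> 0"
      using pmf_run_near[OF near, of h] 0 by simp
    moreover have "0 < pmf (run kernel x T) h * (1 + mass x h)"
      using nz mass_nonneg[of x h] by (simp add: less_le)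
    ultimately show False by simp
  qed
next
  have "0 < 4 * c" using c_pos by simp
  then obtain a b where ab: "0 \<le> a" "0 \<le> b" "1 \<le> b - a"
      "b - a \<le> exp ((real n + 1/2)\<^sup>2 * (4 * c)\<^sup>2 / 2)"
    and chord: "\<And>r. exp (- (4 * c)) \<le> r \<Longrightarrow> r \<le> exp (4 * c) \<Longrightarrow> r ^ Suc n + a \<le> b * r"
    using chord_bound[of "4 * c" n] by blast
  \<comment> \<open>Up to a power of \<open>b - a\<close>, which bounds the divergence of one phase, this is a bound on the
    divergence of the rest of the current phase.\<close>
  define G where "G = (\<lambda>h. (1 + mass x h) ^ Suc n / (1 + mass y h) ^ n *
      (b / (1 + mass x h) - a / (1 + mass y h)))"
  define \<Psi> where "\<Psi> = (\<lambda>h. ennreal ((b - a) ^ (k - updates h) * G h))"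
  \<comment> \<open>The chord bound at the ratio \<open>Y / X\<close>. It keeps the potential
    nonnegative during the steps and allows it to be discarded at the end.\<close>
  have G: "1 \<le> G h" if "length h \<le> T" for h
  proof -
    define X Y where "X = 1 + mass x h" and "Y = 1 + mass y h"
    have XY: "0 < X" "0 < Y"
      using mass_nonneg[of x h] mass_nonneg[of y h] by (auto simp: X_def Y_def)
    have "X \<le> exp c * Y" "Y \<le> exp c * X"
      using mass_near[OF near that] mass_near[OF near_sym[OF near] that] by (auto simp: X_def Y_def)
    then have "exp (- c) \<le> Y / X" "Y / X \<le> exp c"
      using XY by (auto simp: exp_minus field_simps)
    moreover have "exp (- (4 * c)) \<le> exp (- c)" "exp c \<le> exp (4 * c)"
      using c_pos by auto
    ultimately have "(Y / X) ^ Suc n + a \<le> b * (Y / X)"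
      by (intro chord) linarith+
    then have "(Y / X) ^ Suc n * (X / Y) ^ Suc n \<le> (b * (Y / X) - a) * (X / Y) ^ Suc n"
      using XY by (intro mult_right_mono) auto
    moreover have "(Y / X) ^ Suc n * (X / Y) ^ Suc n = 1"
      using XY by (simp add: power_mult_distrib[symmetric] del: power_Suc)
    moreover have "(b * (Y / X) - a) * (X / Y) ^ Suc n = X ^ Suc n / Y ^ n * (b / X - a / Y)"
      using XY by (simp add: power_divide field_simps)
    ultimately show ?thesis
      unfolding G_def X_def[symmetric] Y_def[symmetric] by linarith
  qed
  have step: "(\<integral>\<^sup>+o'. ennreal ((pmf (kernel (take (Suc (length h)) x) h) o' /
                     pmf (kernel (take (Suc (length h)) y) h) o') ^ n) * \<Psi> (o' # h)
         \<partial>kernel (take (Suc (length h)) x) h) \<le> \<Psi> h" if h: "length h < T" for h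
  proof -
    define px py where "px = take (Suc (length h)) x" and "py = take (Suc (length h)) y"
    define X Y w w' where "X = 1 + mass x h" and "Y = 1 + mass y h"
      and "w = weight px h" and "w' = weight py h"
    have XY: "0 < X" "0 < Y" "0 \<le> w" "0 \<le> w'"
      using mass_nonneg[of x h] mass_nonneg[of y h] weight_nonneg by (auto simp: X_def Y_def w_def w'_def)
    have mass_prefix: "mass px h = mass x h" "mass py h = mass y h"
      by (simp_all add: px_def py_def mass_take)
    have X1: "1 + mass x (None # h) = X + w" "1 + mass y (None # h) = Y + w'"
      by (simp_all add: X_def Y_def w_def w'_def px_def py_def)
    define j where "j = k - updates h"
    have None_term: "ennreal ((pmf (kernel px h) None / pmf (kernel py h) None) ^ n) * \<Psi> (None # h) *
        ennreal (X / (X + w)) =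
        ennreal ((b - a) ^ j * (((X / (X + w)) / (Y / (Y + w'))) ^ n * G (None # h) * (X / (X + w))))"
    proof -
      have "0 \<le> G (None # h)" using G[of "None # h"] h by simp
      then show ?thesis
        using XY ab
        by (simp add: \<Psi>_def pmf_kernel_None mass_prefix j_def ennreal_mult[symmetric]
            X_def[symmetric] Y_def[symmetric] w_def[symmetric] w'_def[symmetric] mult_ac)
    qed
    show ?thesis
    proof (cases "updates h < k")
      case False
      \<comment> \<open>A frozen history makes the same move with certainty on both streams, so the
        potential does not change.\<close>
      then have "w = 0" "w' = 0" by (simp_all add: w_def w'_def weight_def)
      moreover have "G (None # h) = G h"
        unfolding G_def X1 by (simp add: \<open>w = 0\<close> \<open>w' = 0\<close> X_def Y_def)
      ultimately show ?thesis
        unfolding px_def[symmetric] py_def[symmetric] nn_integral_kernel mass_prefix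
          X_def[symmetric] Y_def[symmetric] w_def[symmetric] w'_def[symmetric] None_term
        using XY by (simp add: \<Psi>_def j_def)
    next
      case True
      have w: "0 < w" "0 < w'"
        using True by (simp_all add: w_def w'_def weight_def)
      define s where "s = (w / (X * (X + w))) / (w' / (Y * (Y + w')))"
      have s: "0 < s" using XY w by (simp add: s_def)
      have ratio: "s * (pmf (fresh px) v / pmf (fresh py) v) = update_density x h v / update_density y h v" for v
        unfolding s_def update_density_def X1 px_def[symmetric] py_def[symmetric] X_def[symmetric]
          Y_def[symmetric] w_def[symmetric] w'_def[symmetric] by (simp add: mult_ac)
      have density_pos: "0 < update_density x h v" "0 < update_density y h v" for v
        unfolding update_density_def X1 px_def[symmetric] py_def[symmetric] X_def[symmetric]
          Y_def[symmetric] w_def[symmetric] w'_def[symmetric]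
        using XY w pmf_fresh_pos by simp_all
      have chord': "(s * (pmf (fresh px) v / pmf (fresh py) v)) ^ Suc n + a \<le>
          b * (s * (pmf (fresh px) v / pmf (fresh py) v))" for v
        unfolding ratio
        using update_density_near[OF near h, of v] update_density_near[OF near_sym[OF near] h, of v]
          density_pos[of v]
        by (intro chord) (auto simp: exp_minus field_simps)
      note int = nn_integral_ratio_power_le[OF pmf_fresh_pos pmf_fresh_pos s ab(1,2) chord']
      have "(\<integral>\<^sup>+v. ennreal ((pmf (kernel px h) (Some v) / pmf (kernel py h) (Some v)) ^ n) * \<Psi> (Some v # h)
              \<partial>fresh px) =
          (\<integral>\<^sup>+v. ennreal ((b - a) ^ j * (X / Y) ^ n) * ennreal ((s * (pmf (fresh px) v / pmf (fresh py) v)) ^ n)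
              \<partial>fresh px)"
      proof (intro nn_integral_cong)
        fix v
        have j: "j = Suc (k - Suc (updates h))" using True by (simp add: j_def)
        have "pmf (kernel px h) (Some v) / pmf (kernel py h) (Some v) =
            X / Y * (s * (pmf (fresh px) v / pmf (fresh py) v))"
          using XY w unfolding pmf_kernel_Some mass_prefix s_def X_def[symmetric]
            Y_def[symmetric] w_def[symmetric] w'_def[symmetric] by simp
        \<comment> \<open>An update resets both masses to 0, where \<open>G\<close> equals
          \<open>b - a\<close>; this replaces the power that the update uses up.\<close>
        moreover have "\<Psi> (Some v # h) = ennreal ((b - a) ^ j)"
          by (simp add: \<Psi>_def G_def j mult.commute)
        ultimately show "ennreal ((pmf (kernel px h) (Some v) / pmf (kernel py h) (Some v)) ^ n) * \<Psi> (Some v # h) =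
          ennreal ((b - a) ^ j * (X / Y) ^ n) * ennreal ((s * (pmf (fresh px) v / pmf (fresh py) v)) ^ n)"
          using XY s ab by (simp only: power_mult_distrib) (simp add: ennreal_mult[symmetric] mult_ac)
      qed
      also have "\<dots> \<le> ennreal ((b - a) ^ j * (X / Y) ^ n) * ennreal (b - a / s)"
        using int(1) by (subst nn_integral_cmult) (auto intro: mult_left_mono)
      also have "\<dots> = ennreal ((b - a) ^ j * ((X / Y) ^ n * (b - a / s)))"
        using int(2) XY ab by (simp add: ennreal_mult[symmetric] mult.assoc)
      finally have Some_term: "(\<integral>\<^sup>+v. ennreal ((pmf (kernel px h) (Some v) / pmf (kernel py h) (Some v)) ^ n) *
            \<Psi> (Some v # h) \<partial>fresh px) \<le> ennreal ((b - a) ^ j * ((X / Y) ^ n * (b - a / s)))" .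
      have "(\<integral>\<^sup>+o'. ennreal ((pmf (kernel px h) o' / pmf (kernel py h) o') ^ n) * \<Psi> (o' # h) \<partial>kernel px h) \<le>
          ennreal ((b - a) ^ j * ((X / Y) ^ n * (b - a / s))) * ennreal (w / (X + w)) +
          ennreal ((b - a) ^ j * (((X / (X + w)) / (Y / (Y + w'))) ^ n * G (None # h) * (X / (X + w))))"
        unfolding nn_integral_kernel mass_prefix X_def[symmetric] w_def[symmetric] None_term
        by (intro add_right_mono mult_right_mono Some_term) simp
      also have "\<dots> = ennreal ((b - a) ^ j * ((X / Y) ^ n * (b - a / s) * (w / (X + w)) +
          ((X / (X + w)) / (Y / (Y + w'))) ^ n * G (None # h) * (X / (X + w))))"
      proof -
        have "0 \<le> (b - a) ^ j" using ab by simp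
        moreover have "0 \<le> (X / Y) ^ n * (b - a / s)"
          using XY int(2) by (intro mult_nonneg_nonneg) auto
        moreover have "0 \<le> w / (X + w)" using XY by simp
        moreover have "0 \<le> ((X / (X + w)) / (Y / (Y + w'))) ^ n * G (None # h) * (X / (X + w))"
          using XY G[of "None # h"] h by (intro mult_nonneg_nonneg) auto
        ultimately show ?thesis
          by (rule ennreal_distrib)
      qed
      also have "\<dots> = \<Psi> h"
        unfolding G_def X1 potential_split[OF XY(1,2) w s_def]
        by (simp add: \<Psi>_def G_def j_def X_def Y_def)
      finally show ?thesis
        unfolding px_def py_def .
    qed
  qed
  have "(\<integral>\<^sup>+h. ennreal ((pmf (run kernel x T) h / pmf (run kernel y T) h) ^ n) \<partial>run kernel x T) \<le>
      (\<integral>\<^sup>+h. ennreal ((pmf (run kernel x T) h / pmf (run kernel y T) h) ^ n) * \<Psi> h \<partial>run kernel x T)"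
  proof (intro nn_integral_mono_AE, unfold AE_measure_pmf_iff, intro ballI)
    fix h assume "h \<in> set_pmf (run kernel x T)"
    then have "1 \<le> G h" using G length_run by blast
    moreover have "1 \<le> (b - a) ^ (k - updates h)" using ab by simp
    ultimately have "1 * 1 \<le> (b - a) ^ (k - updates h) * G h"
      by (intro mult_mono) auto
    then have "1 \<le> \<Psi> h" by (simp add: \<Psi>_def)
    then show "ennreal ((pmf (run kernel x T) h / pmf (run kernel y T) h) ^ n) \<le>
        ennreal ((pmf (run kernel x T) h / pmf (run kernel y T) h) ^ n) * \<Psi> h"
      using mult_left_mono[of 1 "\<Psi> h"] by simp
  qed
  also have "\<dots> \<le> \<Psi> []"
    by (rule run_potential[OF step order.refl])
  \<comment> \<open>At the start both masses are 0, so \<open>G []\<close> contributes one more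
    factor \<open>b - a\<close>.\<close>
  also have "\<dots> = ennreal ((b - a) ^ (k + 1))"
    by (simp add: \<Psi>_def G_def mult.commute)
  also have "\<dots> \<le> ennreal (exp (real n * \<epsilon>) * \<delta>)"
  proof (rule ennreal_leI)
    have "(b - a) ^ (k + 1) \<le> exp ((real n + 1/2)\<^sup>2 * (4 * c)\<^sup>2 / 2) ^ (k + 1)"
      using ab by (intro power_mono) auto
    also have "\<dots> = exp ((real k + 1) * ((real n + 1/2)\<^sup>2 * (4 * c)\<^sup>2 / 2))"
      by (simp only: exp_of_nat_mult[symmetric] of_nat_add of_nat_1)
    also have "\<dots> \<le> exp (real n * \<epsilon> + ln \<delta>)"
      using budget by simp
    finally show "(b - a) ^ (k + 1) \<le> exp (real n * \<epsilon>) * \<delta>"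
      using \<open>0 < \<delta>\<close> by (simp add: exp_add)
  qed
  finally show "(\<integral>\<^sup>+h. ennreal ((pmf (run kernel x T) h / pmf (run kernel y T) h) ^ n) \<partial>run kernel x T) \<le>
      ennreal (exp (real n * \<epsilon>) * \<delta>)" .
qed (use assms in simp)

end

section \<open>Lazy updates: accuracy\<close>

lemma run_expectation:
  fixes k :: "stream \<Rightarrow> 'a list \<Rightarrow> 'a pmf"
  assumes "\<And>h. length h < T \<Longrightarrow>
      (\<integral>\<^sup>+a. \<Psi> (a # h) \<partial>k (take (Suc (length h)) x) h) \<le> \<Psi> h"
  shows "(\<integral>\<^sup>+h. \<Psi> h \<partial>run k x T) \<le> \<Psi> []"
  using run_potential[of T k x x 0 \<Psi> T] assms by simp

text \<open>Markov's inequality in place of a union bound: every bad history costs at least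
  1.\<close>

lemma prob_run_ge_of_cost:
  fixes cost :: "'a list \<Rightarrow> real"
  assumes cost: "(\<integral>\<^sup>+h. ennreal (cost h) \<partial>run k x T) \<le> ennreal b" and "0 \<le> b"
    and good: "\<And>h. length h = T \<Longrightarrow> cost h < 1 \<Longrightarrow> P h"
  shows "1 - b \<le> measure_pmf.prob (run k x T) {h. P h}"
proof -
  have "emeasure (measure_pmf (run k x T)) (- {h. P h}) = (\<integral>\<^sup>+h. indicator (- {h. P h}) h \<partial>run k x T)"
    by simp
  also have "\<dots> \<le> (\<integral>\<^sup>+h. ennreal (cost h) \<partial>run k x T)"
  proof (intro nn_integral_mono_AE, unfold AE_measure_pmf_iff, intro ballI)
    fix h assume "h \<in> set_pmf (run k x T)"
    then have "P h \<or> 1 \<le> cost h" using good length_run by (metis not_le)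
    then show "indicator (- {h. P h}) h \<le> ennreal (cost h)"
      by (auto simp: indicator_def)
  qed
  finally have "ennreal (measure_pmf.prob (run k x T) (- {h. P h})) \<le> ennreal b"
    using cost by (simp add: measure_pmf.emeasure_eq_measure)
  then have "measure_pmf.prob (run k x T) (- {h. P h}) \<le> b"
    using \<open>0 \<le> b\<close> by simp
  then show ?thesis
    using measure_pmf.prob_compl[of "{h. P h}" "run k x T"] by (simp add: Compl_eq_Diff_UNIV)
qed

context lazy_updates
begin

text \<open>All thresholds are multiples of \<open>\<kappa> / c\<close>: a fresh value errs by at
  most 2 units, an update at error below 3 is early, the weight reaches 1 at error 4, and the final
  error bound is 5. One unit corresponds to a factor \<open>exp \<kappa>\<close> in the
  weight.\<close>

context
  fixes \<kappa> :: real and x :: stream and T j :: nat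
  assumes lam: "0 < \<kappa>" and tau: "\<tau> = 4 * \<kappa> / c"
    and j: "j = nat \<lceil>\<kappa> * real m / c\<rceil>" and fine: "2 / real m \<le> \<kappa> / c"
begin

definition bad_update :: "int option list \<Rightarrow> int \<Rightarrow> bool" where
  "bad_update h v \<longleftrightarrow>
     int j < \<bar>v - \<lfloor>real m * (Q (take (Suc (length h)) x) - Q [])\<rfloor>\<bar>"

definition early :: "int option list \<Rightarrow> bool" where
  "early h \<longleftrightarrow> \<bar>Q (take (Suc (length h)) x) - published h\<bar> < 3 * \<kappa> / c"

text \<open>
  The last summand charges for steps at which the mass is large, so that histories of cost below
  \<open>1\<close> have mass below \<open>exp \<kappa>\<close>. As the expected value of \<open>1 + mass\<close> grows by at most \<open>1\<close> per step,
  the charges are small on average.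
\<close>

primrec cost :: "int option list \<Rightarrow> real" where
  "cost [] = 0"
| "cost (a # h) = cost h +
     (case a of None \<Rightarrow> 0 | Some v \<Rightarrow> of_bool (early h) + of_bool (bad_update h v)) +
     exp (- \<kappa>) * (1 + mass x (a # h))"

lemma cost_mono: "cost h \<le> cost (a # h)" "0 \<le> cost h"
proof -
  have "0 \<le> exp (- \<kappa>) * (1 + mass x h)" for h
    by (intro mult_nonneg_nonneg add_nonneg_nonneg mass_nonneg) auto
  then have *: "cost h \<le> cost (a # h)" for h a
    unfolding cost.simps(2) by (auto split: option.split intro: add_increasing2 simp del: mass.simps)
  then show "cost h \<le> cost (a # h)" .
  show "0 \<le> cost h"
    by (induction h) (auto simp del: cost.simps(2) intro: order.trans[OF _ *])
qed

text \<open>Earlier histories are no more expensive, so a single condition on the final history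
  controls all time steps.\<close>

lemma cost_drop: "cost (drop i h) \<le> cost h"
proof (induction i arbitrary: h)
  case (Suc i)
  then show ?case
    by (cases h) (use order.trans[OF _ cost_mono(1)] in \<open>auto simp del: cost.simps(2)\<close>)
qed simp

lemma prob_bad_update: "measure_pmf.prob (fresh (take (Suc (length h)) x)) {v. bad_update h v} \<le> exp (- \<kappa>)"
proof -
  have "\<kappa> * real m / c \<le> real j"
    unfolding j by linarith
  then have "c / real m * (\<kappa> * real m / c) \<le> c / real m * real j"
    using c_pos by (intro mult_left_mono) auto
  then have "\<kappa> \<le> c / real m * real j"
    using c_pos m_pos by simp
  then have "exp (- (c / real m * real j)) \<le> exp (- \<kappa>)" by simp
  with discrete_laplace_tail[of "c / real m" _ j] show ?thesis
    using c_pos m_pos unfolding fresh_def bad_update_def by (meson divide_pos_pos of_nat_0_less_iff order.trans)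
qed

lemma expected_cost:
  "(\<integral>\<^sup>+h. ennreal (cost h) \<partial>run kernel x T) \<le> ennreal (real T * (real T + 4) * exp (- \<kappa>))"
proof -
  let ?e = "exp (- \<kappa>)"
  \<comment> \<open>A reserve for the remaining steps is added to the cost. Per step it covers the
    current \<open>1 + mass\<close>, its expected growth of at most \<open>T\<close>, and the two
    ways an update can fail.\<close>
  define \<Phi> where "\<Phi> = (\<lambda>h. cost h + real (T - length h) * (?e * (1 + mass x h + real T + 3)))"
  have step: "(\<integral>\<^sup>+a. ennreal (\<Phi> (a # h)) \<partial>kernel (take (Suc (length h)) x) h) \<le> ennreal (\<Phi> h)"
    if h: "length h < T" for h
  proof -
    define p where "p = take (Suc (length h)) x"
    define X w where "X = 1 + mass x h" and "w = weight p h"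
    have Xw: "1 \<le> X" "0 \<le> w" using mass_nonneg weight_nonneg by (auto simp: X_def w_def)
    have mass_prefix: "mass p h = mass x h" by (simp add: p_def mass_take)
    have X1: "1 + mass x (None # h) = X + w" by (simp add: X_def w_def p_def)
    define rem A B g where "rem = real (T - length h)" and "A = cost h + (rem - 1) * (?e * (real T + 3))"
      and "B = ?e * rem" and "g = (of_bool (early h) :: real)"
    define b where "b = measure_pmf.prob (fresh p) {v. bad_update h v}"
    have rem: "1 \<le> rem" "rem \<le> real T" "real (T - Suc (length h)) = rem - 1"
      using h by (auto simp: rem_def of_nat_diff)
    have nonneg: "0 \<le> A" "0 \<le> B" "0 \<le> g" "0 \<le> b"
      using rem cost_mono(2) by (auto simp: A_def B_def g_def b_def intro!: add_nonneg_nonneg mult_nonneg_nonneg)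
    have b: "b \<le> ?e" using prob_bad_update by (simp add: b_def p_def)
    \<comment> \<open>An early step has error at least one unit below \<open>\<tau>\<close>.\<close>
    have gw: "g * w \<le> ?e"
    proof (cases "early h \<and> updates h < k")
      case True
      then have "c * (\<bar>Q p - published h\<bar> - \<tau>) \<le> c * (3 * \<kappa> / c - 4 * \<kappa> / c)"
        using c_pos tau by (intro mult_left_mono) (auto simp: early_def p_def)
      also have "\<dots> = - \<kappa>" using c_pos by (simp add: field_simps)
      finally show ?thesis using True by (simp add: g_def w_def weight_def)
    qed (auto simp: g_def w_def weight_def)
    have "\<Phi> (None # h) = A + B * (X + w)"
      unfolding \<Phi>_def cost.simps(2) X1 by (simp add: rem A_def B_def algebra_simps)
    moreover have "\<Phi> (Some v # h) = A + B + g + of_bool (bad_update h v)" for v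
      unfolding \<Phi>_def by (simp add: rem A_def B_def g_def algebra_simps)
    moreover have "(\<integral>\<^sup>+v. ennreal (A + B + g + of_bool (bad_update h v)) \<partial>fresh p) = ennreal (A + B + g + b)"
    proof -
      have "(\<integral>\<^sup>+v. ennreal (A + B + g + of_bool (bad_update h v)) \<partial>fresh p) =
          (\<integral>\<^sup>+v. ennreal (A + B + g) + indicator {v. bad_update h v} v \<partial>fresh p)"
        using nonneg by (intro nn_integral_cong) (auto simp: indicator_def)
      also have "\<dots> = ennreal (A + B + g) + ennreal b"
        by (subst nn_integral_add) (auto simp: b_def measure_pmf.emeasure_eq_measure)
      finally show ?thesis using nonneg by simp
    qed
    ultimately have "(\<integral>\<^sup>+a. ennreal (\<Phi> (a # h)) \<partial>kernel p h) =
        ennreal (A + B + g + b) * ennreal (w / (X + w)) + ennreal (A + B * (X + w)) * ennreal (X / (X + w))"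
      unfolding nn_integral_kernel mass_prefix X_def[symmetric] w_def[symmetric] by simp
    also have "\<dots> = ennreal ((A + B + g + b) * (w / (X + w)) + (A + B * (X + w)) * (X / (X + w)))"
      using nonneg Xw by (simp flip: ennreal_mult ennreal_plus)
    also have "\<dots> \<le> ennreal (\<Phi> h)"
    proof (rule ennreal_leI)
      have pos: "0 < X + w" using Xw by simp
      \<comment> \<open>The no-update probability \<open>X / (X + w)\<close> cancels the new mass
        \<open>X + w\<close>, so the mean of \<open>1 + mass\<close> rises only from
        \<open>X\<close> to \<open>X + w / (X + w)\<close>.\<close>
      have "(A + B + g + b) * (w / (X + w)) + (A + B * (X + w)) * (X / (X + w)) =
          A + B * X + (B * (w / (X + w)) + b * (w / (X + w)) + g * w / (X + w))"
      proof -
        define u z where "u = w / (X + w)" and "z = X / (X + w)"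
        have z: "(X + w) * z = X" "z = 1 - u"
          using pos by (simp_all add: u_def z_def field_simps)
        have "(A + B + g + b) * u + (A + B * (X + w)) * z =
            (A + B + g + b) * u + A * z + B * ((X + w) * z)"
          by (simp add: algebra_simps)
        also have "\<dots> = (A + B + g + b) * u + A * (1 - u) + B * X"
          unfolding z(1) unfolding z(2) ..
        finally show ?thesis
          by (simp add: u_def[symmetric] z_def[symmetric] times_divide_eq_right[symmetric] algebra_simps
              del: times_divide_eq_right)
      qed
      also have "\<dots> \<le> A + B * X + (B * 1 + ?e * 1 + ?e)"
      proof (intro add_left_mono add_mono mult_mono)
        have "g * w / (X + w) \<le> g * w"
          using Xw mult_nonneg_nonneg[OF nonneg(3) Xw(2)] by (simp add: divide_le_eq mult_le_cancel_left1)
        then show "g * w / (X + w) \<le> ?e" using gw by linarith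
      qed (use Xw nonneg b in auto)
      also have "\<dots> \<le> \<Phi> h"
      proof -
        have "?e * rem \<le> ?e * (real T + 1)" using rem by simp
        moreover have "\<Phi> h = cost h + ?e * (rem * X + rem * (real T + 3))"
          by (simp add: \<Phi>_def rem_def X_def algebra_simps)
        ultimately show ?thesis
          by (simp add: A_def B_def algebra_simps)
      qed
      finally show "(A + B + g + b) * (w / (X + w)) + (A + B * (X + w)) * (X / (X + w)) \<le> \<Phi> h" .
    qed
    finally show ?thesis unfolding p_def .
  qed
  have "(\<integral>\<^sup>+h. ennreal (cost h) \<partial>run kernel x T) = (\<integral>\<^sup>+h. ennreal (\<Phi> h) \<partial>run kernel x T)"
    by (intro nn_integral_cong_AE) (auto simp: AE_measure_pmf_iff \<Phi>_def dest: length_run)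
  also have "\<dots> \<le> ennreal (\<Phi> [])"
    by (rule run_expectation[where k = kernel and x = x and T = T and \<Psi> = "\<lambda>h. ennreal (\<Phi> h)", OF step])
  also have "\<Phi> [] = real T * (real T + 4) * ?e"
    by (simp add: \<Phi>_def algebra_simps)
  finally show ?thesis .
qed

text \<open>
  An update that is neither early nor badly placed shrinks the error by at least \<open>\<kappa> / c\<close>, and
  only the variation of \<open>Q\<close> can increase it. This limits the number of updates.
\<close>

lemma error_potential:
  "cost h < 1 \<Longrightarrow>
     \<bar>Q (take (length h) x) - published h\<bar> + \<kappa> / c * real (updates h) \<le>
       (\<Sum>t=1..length h. \<bar>Q (take t x) - Q (take (t - 1) x)\<bar>) \<and>
     (case h of Some v # h' \<Rightarrow> \<bar>Q (take (length h) x) - published h\<bar> \<le> 2 * \<kappa> / c | _ \<Rightarrow> True)"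
proof (induction h)
  case Nil
  then show ?case by (simp add: published_def)
next
  case (Cons a h)
  let ?q = "Q (take (Suc (length h)) x)"
  have IH: "\<bar>Q (take (length h) x) - published h\<bar> + \<kappa> / c * real (updates h) \<le>
       (\<Sum>t=1..length h. \<bar>Q (take t x) - Q (take (t - 1) x)\<bar>)"
    using Cons cost_mono(1)[of h a] by linarith
  show ?case
  proof (cases a)
    case None
    then show ?thesis
      using IH by (simp add: published_def)
  next
    case (Some v)
    have "of_bool (early h) + of_bool (bad_update h v) < (1 :: real)"
      using Cons.prems Some cost_mono(2)[of h] exp_gt_zero[of "- \<kappa>"]
      unfolding cost.simps(2) by (simp only: option.case mass.simps add_0_right mult_1_right)
    then have "\<not> early h" "\<not> bad_update h v"
      by (auto simp: of_bool_def split: if_splits)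
    let ?r = "real m * (?q - Q [])"
    have v: "\<bar>v - \<lfloor>?r\<rfloor>\<bar> \<le> int j"
      using \<open>\<not> bad_update h v\<close> by (simp add: bad_update_def)
    then have "\<bar>real_of_int v - ?r\<bar> \<le> real j + 1" by linarith
    \<comment> \<open>One extra grid step comes from the floor of \<open>?r\<close> and one from
      rounding \<open>j\<close> up; \<open>fine\<close> absorbs both.\<close>
    also have "\<dots> \<le> \<kappa> * real m / c + 2"
      using lam c_pos by (simp add: j) linarith
    also have "\<dots> \<le> real m * (2 * \<kappa> / c)"
      using fine m_pos c_pos by (simp add: field_simps)
    finally have "\<bar>real_of_int v - ?r\<bar> / real m \<le> 2 * \<kappa> / c"
      using m_pos by (simp add: divide_le_eq mult.commute)
    moreover have "\<bar>real_of_int v - ?r\<bar> / real m = \<bar>?q - published (a # h)\<bar>"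
    proof -
      have "(real_of_int v - ?r) / real m = published (a # h) - ?q"
        using Some m_pos by (simp add: published_def field_simps)
      then show ?thesis
        by (metis abs_divide abs_minus_commute abs_of_nat)
    qed
    ultimately have near_q: "\<bar>?q - published (a # h)\<bar> \<le> 2 * \<kappa> / c" by simp
    have "3 * \<kappa> / c \<le> \<bar>?q - published h\<bar>"
      using \<open>\<not> early h\<close> by (simp add: early_def)
    also have "\<dots> \<le> \<bar>?q - Q (take (length h) x)\<bar> + \<bar>Q (take (length h) x) - published h\<bar>"
      by simp
    finally have large: "3 * \<kappa> / c \<le> \<bar>?q - Q (take (length h) x)\<bar> + \<bar>Q (take (length h) x) - published h\<bar>" .
    have "\<bar>?q - published (a # h)\<bar> + \<kappa> / c * real (updates (a # h)) \<le>
        \<kappa> / c * real (updates h) + \<bar>?q - Q (take (length h) x)\<bar> + \<bar>Q (take (length h) x) - published h\<bar>"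
    proof -
      have "3 * \<kappa> / c = 2 * \<kappa> / c + \<kappa> / c"
        by (simp add: add_divide_distrib[symmetric])
      moreover have "\<kappa> / c * real (updates (a # h)) = \<kappa> / c * real (updates h) + \<kappa> / c"
        by (simp add: Some distrib_left)
      ultimately show ?thesis
        using near_q large
        by linarith
    qed
    also have "\<dots> \<le> (\<Sum>t=1..length (a # h). \<bar>Q (take t x) - Q (take (t - 1) x)\<bar>)"
      using IH by simp
    finally show ?thesis
      using near_q Some by simp
  qed
qed

text \<open>Right after an update the noise bound suffices. Otherwise the small mass bounds the last
  weight by \<open>exp \<kappa>\<close> and hence the error, provided that the mechanism is not
  frozen; \<open>enough\<close> ensures this, either by the number of steps or by the available
  variation.\<close>

lemma accuracy:
  assumes enough: "T \<le> k \<or> total_variation T Q x < real k * (\<kappa> / c)"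
  shows "1 - real T * (real T + 4) * exp (- \<kappa>) \<le> measure_pmf.prob (run kernel x T)
    {h. \<forall>t\<in>{1..T}. \<bar>published (drop (T - t) h) - Q (take t x)\<bar> \<le> 5 * \<kappa> / c}"
proof (rule prob_run_ge_of_cost[OF expected_cost])
  have good: "\<bar>published h - Q (take (length h) x)\<bar> \<le> 5 * \<kappa> / c"
    if h: "length h \<le> T" "cost h < 1" "h \<noteq> []" for h
  proof (cases h)
    case (Cons a h')
    show ?thesis
    proof (cases a)
      case (Some v)
      then have "\<bar>Q (take (length h) x) - published h\<bar> \<le> 2 * \<kappa> / c"
        using error_potential[OF h(2)] Cons by simp
      moreover have "2 * \<kappa> / c \<le> 5 * \<kappa> / c" using lam c_pos by (simp add: divide_right_mono)
      ultimately show ?thesis by linarith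
    next
      case None
      have "updates h' < k"
      proof (rule ccontr)
        assume "\<not> updates h' < k"
        moreover have "updates h' < T"
          using updates_le_length[of h'] h Cons by simp
        ultimately have few: "total_variation T Q x < real k * (\<kappa> / c)" using enough by linarith
        have "real k * (\<kappa> / c) \<le> \<kappa> / c * real (updates h)"
          using \<open>\<not> updates h' < k\<close> lam c_pos Cons None by (simp add: divide_right_mono mult.commute)
        also have "\<dots> \<le> (\<Sum>t=1..length h. \<bar>Q (take t x) - Q (take (t - 1) x)\<bar>)"
          using error_potential[OF h(2)] by linarith
        also have "\<dots> \<le> total_variation T Q x"
          unfolding total_variation_def using h by (intro sum_mono2) auto
        finally show False using few by simp
      qed
      have "exp (- \<kappa>) * (1 + mass x h) < 1"
        using h(2) cost_mono(2)[of h'] Cons None by simp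
      then have "1 + mass x h < exp \<kappa>"
        by (simp add: exp_minus field_simps)
      then have "weight (take (length h) x) h' < exp \<kappa>"
        using mass_nonneg[of x h'] Cons None by simp
      then have "c * (\<bar>Q (take (length h) x) - published h'\<bar> - \<tau>) < \<kappa>"
        using \<open>updates h' < k\<close> by (simp add: weight_def)
      then have "\<bar>Q (take (length h) x) - published h'\<bar> < 5 * \<kappa> / c"
        using c_pos by (simp add: tau field_simps)
      moreover have "published h' = published h"
        using Cons None by (simp add: published_def)
      ultimately show ?thesis by simp
    qed
  qed (use h in simp)
  fix h :: "int option list" assume h: "length h = T" "cost h < 1"
  show "\<forall>t\<in>{1..T}. \<bar>published (drop (T - t) h) - Q (take t x)\<bar> \<le> 5 * \<kappa> / c"
  proof
    fix t assume t: "t \<in> {1..T}"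
    then have "T - t < T" by auto
    then show "\<bar>published (drop (T - t) h) - Q (take t x)\<bar> \<le> 5 * \<kappa> / c"
      using good[of "drop (T - t) h"] cost_drop[of "T - t" h] h t by simp
  qed
qed simp

end

end

section \<open>Choice of parameters\<close>

definition achievable ::
    "nat \<Rightarrow> nat \<Rightarrow> (stream \<Rightarrow> real) \<Rightarrow> stream set \<Rightarrow> real \<Rightarrow> real \<Rightarrow> real \<Rightarrow> real \<Rightarrow> bool" where
  "achievable d T Q X \<epsilon> \<delta> \<alpha> \<beta> \<longleftrightarrow>
     (\<exists>M A. continual_algorithm M A \<and> item_level_dp d T \<epsilon> \<delta> M A \<and> accurate T Q X M A \<alpha> \<beta>)"

lemma deviation_le_total_variation:
  "t \<le> T \<Longrightarrow> \<bar>Q (take t x) - Q []\<bar> \<le> total_variation T Q x"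
proof -
  assume "t \<le> T"
  have "\<bar>Q (take t x) - Q []\<bar> \<le> total_variation t Q x"
  proof (induction t)
    case (Suc t)
    then show ?case by (simp add: total_variation_def)
  qed (simp add: total_variation_def)
  also have "\<dots> \<le> total_variation T Q x"
    unfolding total_variation_def using \<open>t \<le> T\<close> by (intro sum_mono2) auto
  finally show ?thesis .
qed

lemma total_variation_nonneg: "0 \<le> total_variation T Q x"
  by (simp add: total_variation_def sum_nonneg)

text \<open>The algorithm always answers \<open>Q []\<close>. A negative \<open>K\<close> forces
  \<open>X\<close> to be empty, which is why the bound on \<open>\<alpha>\<close> is asked only for
  nonnegative \<open>K\<close>.\<close>

lemma achievable_constant:
  assumes inst: "admissible_instance d T \<beta> K Q X" and "0 \<le> \<epsilon>" "0 \<le> \<delta>"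
    and le: "0 \<le> K \<Longrightarrow> K \<le> \<alpha>"
  shows "achievable d T Q X \<epsilon> \<delta> \<alpha> \<beta>"
  unfolding achievable_def
proof (rule realize_kernel)
  let ?k = "\<lambda>p h. return_pmf ()"
  show "measure_pmf.prob (run ?k x T) E \<le> exp \<epsilon> * measure_pmf.prob (run ?k y T) E + \<delta>" for x y E
  proof -
    have "run ?k x T = run ?k y T" by (induction T) simp_all
    moreover have "1 * measure_pmf.prob (run ?k y T) E \<le> exp \<epsilon> * measure_pmf.prob (run ?k y T) E"
      using \<open>0 \<le> \<epsilon>\<close> by (intro mult_right_mono) auto
    ultimately show ?thesis using \<open>0 \<le> \<delta>\<close> by simp
  qed
  fix x assume "x \<in> X"
  then have TV: "total_variation T Q x \<le> K"
    using inst by (auto simp: admissible_instance_def)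
  then have "K \<le> \<alpha>" using le total_variation_nonneg[of T Q x] by linarith
  then have "\<bar>Q [] - Q (take t x)\<bar> \<le> \<alpha>" if "t \<in> {1..T}" for t
    using deviation_le_total_variation[of t T Q x] that TV by (simp add: abs_minus_commute)
  then have "{h :: unit list. \<forall>t\<in>{1..T}. \<bar>Q [] - Q (take t x)\<bar> \<le> \<alpha>} = UNIV" by auto
  then show "1 - \<beta> \<le> measure_pmf.prob (run ?k x T) {h. \<forall>t\<in>{1..T}. \<bar>(\<lambda>_. Q []) (drop (T - t) h) - Q (take t x)\<bar> \<le> \<alpha>}"
    using inst by (simp add: admissible_instance_def)
qed (use inst in \<open>auto simp: admissible_instance_def\<close>)

text \<open>Lazy updates with \<open>\<kappa> = 4 * L\<close>: then \<open>exp (- \<kappa>)\<close>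
  is \<open>(\<beta> / T)^4\<close>, which outweighs the factor \<open>T * (T + 4)\<close> of the
  expected cost, and the error \<open>5 * \<kappa> / c\<close> is \<open>20 * L / c\<close>.\<close>

lemma achievable_lazy:
  assumes inst: "admissible_instance d T \<beta> K Q X"
    and L: "L = ln (real T / \<beta>)" "2 \<le> real T / \<beta>" and "0 < c"
    and enough: "T \<le> k \<or> K < real k * (4 * L / c)" and le: "20 * L / c \<le> \<alpha>"
    and budget: "\<delta> = 0 \<and> (4 * real k + 1) * c \<le> \<epsilon> \<or>
      0 < \<delta> \<and> (real k + 1) * ((real n + 1/2)\<^sup>2 * (4 * c)\<^sup>2 / 2) \<le> real n * \<epsilon> + ln \<delta>"
  shows "achievable d T Q X \<epsilon> \<delta> \<alpha> \<beta>"
  unfolding achievable_def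
proof (rule realize_kernel)
  have T: "1 \<le> T" and beta: "0 < \<beta>" "\<beta> < 1"
    using inst by (auto simp: admissible_instance_def)
  have "0 < L" using L by simp
  define m where "m = nat \<lceil>c / (2 * L)\<rceil> + 1"
  have "c / (2 * L) \<le> real m" unfolding m_def by linarith
  moreover have "0 < real m" by (simp add: m_def)
  ultimately have fine: "2 / real m \<le> 4 * L / c"
    using \<open>0 < L\<close> \<open>0 < c\<close> by (simp add: field_simps)
  interpret lazy_updates Q c "4 * (4 * L) / c" m k
    using \<open>0 < c\<close> by unfold_locales (auto simp: m_def)
  show "measure_pmf.prob (run kernel x T) E \<le> exp \<epsilon> * measure_pmf.prob (run kernel y T) E + \<delta>"
    if "item_neighboring d T x y" for x y E
  proof -
    have near: "near T x y"
      using inst that by (auto simp: admissible_instance_def item_sensitivity_le_one_def near_def)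
    show ?thesis
      using budget
    proof (elim disjE conjE)
      assume "\<delta> = 0" "(4 * real k + 1) * c \<le> \<epsilon>"
      have "exp ((4 * real k + 1) * c) * measure_pmf.prob (run kernel y T) E \<le>
          exp \<epsilon> * measure_pmf.prob (run kernel y T) E"
        using \<open>(4 * real k + 1) * c \<le> \<epsilon>\<close> by (intro mult_right_mono) auto
      with pure_privacy[OF near, of E] show ?thesis using \<open>\<delta> = 0\<close> by linarith
    qed (rule approx_privacy[OF near])
  qed
  fix x assume "x \<in> X"
  then have "total_variation T Q x \<le> K"
    using inst by (auto simp: admissible_instance_def)
  then have "T \<le> k \<or> total_variation T Q x < real k * ((4 * L) / c)"
    using enough by linarith
  with \<open>0 < L\<close> fine have "1 - real T * (real T + 4) * exp (- (4 * L)) \<le>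
    measure_pmf.prob (run kernel x T)
      {h. \<forall>t\<in>{1..T}. \<bar>published (drop (T - t) h) - Q (take t x)\<bar> \<le> 5 * (4 * L) / c}"
    by (intro accuracy) auto
  also have "\<dots> \<le> measure_pmf.prob (run kernel x T)
      {h. \<forall>t\<in>{1..T}. \<bar>published (drop (T - t) h) - Q (take t x)\<bar> \<le> \<alpha>}"
    using le by (intro measure_pmf.finite_measure_mono) fastforce+
  finally have *: "1 - real T * (real T + 4) * exp (- (4 * L)) \<le> \<dots>" .
  have "real T * (real T + 4) * exp (- (4 * L)) \<le> \<beta>"
  proof -
    define b where "b = \<beta> / real T"
    have b: "0 < b" "b \<le> 1 / 2" "\<beta> = b * real T"
      using T beta L(2) by (auto simp: b_def field_simps)
    have "exp (- L) = b"
      using T beta unfolding L(1) b_def by (simp add: exp_minus)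
    moreover have "exp (- (4 * L)) = exp (- L) ^ 4"
      using exp_of_nat_mult[of 4 "- L"] by simp
    ultimately have "real T * (real T + 4) * exp (- (4 * L)) = \<beta> * (b ^ 2 * (b * (real T + 4)))"
      by (simp add: b(3) power2_eq_square power4_eq_xxxx)
    also have "\<dots> \<le> \<beta> * 1"
    proof (intro mult_left_mono)
      have "b ^ 2 \<le> (1 / 2) ^ 2" using b by (intro power_mono) auto
      \<comment> \<open>This product is \<open>\<beta> + 4 * b\<close>, with
        \<open>\<beta> < 1\<close> and \<open>b \<le> 1 / 2\<close>.\<close>
      moreover have "b * (real T + 4) \<le> 3"
        using b(1,2) beta(2) unfolding b(3) by (simp add: distrib_left)
      ultimately have "b ^ 2 * (b * (real T + 4)) \<le> (1 / 2) ^ 2 * 3"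
        using b(1) by (intro mult_mono) auto
      then show "b ^ 2 * (b * (real T + 4)) \<le> 1" by (simp add: power2_eq_square)
    qed (use beta in simp)
    finally show ?thesis by simp
  qed
  then show "1 - \<beta> \<le> measure_pmf.prob (run kernel x T)
      {h. \<forall>t\<in>{1..T}. \<bar>published (drop (T - t) h) - Q (take t x)\<bar> \<le> \<alpha>}"
    using * by linarith
qed (use inst in \<open>auto simp: admissible_instance_def\<close>)

text \<open>The tail of one Laplace release is \<open>exp (- L) = \<beta>\<close> without any extra
  factor, so the bound survives \<open>\<beta>\<close> close to 1, where \<open>L\<close> tends to
  0. Of the three units \<open>L / \<epsilon>\<close>, one is the tail radius and two pay for
  rounding.\<close>

lemma achievable_single_release:
  assumes inst: "admissible_instance d 1 \<beta> K Q X" and "0 < \<epsilon>" "0 \<le> \<delta>"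
    and le: "3 * ln (1 / \<beta>) / \<epsilon> \<le> \<alpha>"
  shows "achievable d 1 Q X \<epsilon> \<delta> \<alpha> \<beta>"
  unfolding achievable_def
proof (rule realize_kernel)
  have beta: "0 < \<beta>" "\<beta> < 1"
    using inst by (auto simp: admissible_instance_def)
  define L where "L = ln (1 / \<beta>)"
  have "0 < L" using beta by (simp add: L_def)
  define m where "m = nat \<lceil>\<epsilon> / L\<rceil> + 1"
  have "\<epsilon> / L \<le> real m" unfolding m_def by linarith
  moreover have "0 < real m" by (simp add: m_def)
  ultimately have fine: "1 / real m \<le> L / \<epsilon>"
    using \<open>0 < L\<close> \<open>0 < \<epsilon>\<close> by (simp add: field_simps)
  \<comment> \<open>The locale is entered for \<open>fresh\<close> and its privacy bound, with rate
    \<open>\<epsilon>\<close>.\<close>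
  interpret lazy_updates Q \<epsilon> 0 m 0
    using \<open>0 < \<epsilon>\<close> by unfold_locales (auto simp: m_def)
  let ?k = "\<lambda>p (h :: int list). fresh p" and ?out = "\<lambda>h. Q [] + real_of_int (hd h) / real m"
  have run: "run ?k x 1 = map_pmf (\<lambda>a. [a]) (fresh (take 1 x))" for x
    by (simp add: bind_return_pmf)
  show "measure_pmf.prob (run ?k x 1) E \<le> exp \<epsilon> * measure_pmf.prob (run ?k y 1) E + \<delta>"
    if "item_neighboring d 1 x y" for x y E
  proof -
    have near: "near 1 x y"
      using inst that by (auto simp: admissible_instance_def item_sensitivity_le_one_def near_def)
    have "measure_pmf.prob (fresh (take 1 x)) E' \<le> exp \<epsilon> * measure_pmf.prob (fresh (take 1 y)) E' + 0" for E'
      using fresh_near[OF near, of 1] by (intro prob_le_of_pmf_le[where g = "\<lambda>_. 0"]) auto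
    then show ?thesis
      unfolding run using \<open>0 \<le> \<delta>\<close> by (simp add: add_increasing2)
  qed
  fix x assume "x \<in> X"
  define r where "r = real m * (Q (take 1 x) - Q [])"
  define j where "j = nat \<lceil>L * real m / \<epsilon>\<rceil>"
  have j: "L * real m / \<epsilon> \<le> real j" "real j \<le> L * real m / \<epsilon> + 1"
    using \<open>0 < L\<close> \<open>0 < \<epsilon>\<close> by (auto simp: j_def)
  have close: "\<bar>?out [v] - Q (take 1 x)\<bar> \<le> \<alpha>" if "\<bar>v - \<lfloor>r\<rfloor>\<bar> \<le> int j" for v
  proof -
    have "\<bar>real_of_int v - r\<bar> \<le> real j + 1" using that by linarith
    also have "\<dots> \<le> real m * (L / \<epsilon> + 2 / real m)"
      using j m_pos by (simp add: distrib_left mult.commute)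
    also have "\<dots> \<le> real m * (3 * L / \<epsilon>)"
    proof (intro mult_left_mono)
      have "2 / real m = 2 * (1 / real m)" "3 * L / \<epsilon> = 3 * (L / \<epsilon>)" by simp_all
      then show "L / \<epsilon> + 2 / real m \<le> 3 * L / \<epsilon>" using fine by linarith
    qed simp
    also have "\<dots> \<le> real m * \<alpha>"
      using le by (intro mult_left_mono) (auto simp: L_def)
    finally have "\<bar>real_of_int v - r\<bar> / real m \<le> \<alpha>"
      using m_pos by (simp add: divide_le_eq mult.commute)
    moreover have "\<bar>real_of_int v - r\<bar> / real m = \<bar>?out [v] - Q (take 1 x)\<bar>"
    proof -
      have "(real_of_int v - r) / real m = ?out [v] - Q (take 1 x)"
        using m_pos by (simp add: r_def field_simps)
      then show ?thesis by (metis abs_divide abs_of_nat)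
    qed
    ultimately show ?thesis by linarith
  qed
  have "exp (- (\<epsilon> / real m * real j)) \<le> exp (- L)"
  proof -
    have "\<epsilon> / real m * (L * real m / \<epsilon>) \<le> \<epsilon> / real m * real j"
      using j \<open>0 < \<epsilon>\<close> by (intro mult_left_mono) auto
    then show ?thesis using m_pos \<open>0 < \<epsilon>\<close> by simp
  qed
  also have "exp (- L) = \<beta>" using beta by (simp add: L_def ln_div)
  finally have "measure_pmf.prob (fresh (take 1 x)) {v. int j < \<bar>v - \<lfloor>r\<rfloor>\<bar>} \<le> \<beta>"
    using discrete_laplace_tail[of "\<epsilon> / real m" "\<lfloor>r\<rfloor>" j] m_pos \<open>0 < \<epsilon>\<close>
    unfolding fresh_def r_def by (meson divide_pos_pos of_nat_0_less_iff order.trans)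
  moreover have "measure_pmf.prob (fresh (take 1 x)) {v. \<not> int j < \<bar>v - \<lfloor>r\<rfloor>\<bar>} =
      1 - measure_pmf.prob (fresh (take 1 x)) {v. int j < \<bar>v - \<lfloor>r\<rfloor>\<bar>}"
    by (subst measure_pmf.prob_compl[symmetric]) (auto intro: arg_cong[where f = "measure _"])
  moreover have "measure_pmf.prob (fresh (take 1 x)) {v. \<not> int j < \<bar>v - \<lfloor>r\<rfloor>\<bar>} \<le>
      measure_pmf.prob (fresh (take 1 x)) {v. \<bar>?out [v] - Q (take 1 x)\<bar> \<le> \<alpha>}"
    using close by (intro measure_pmf.finite_measure_mono) auto
  ultimately show "1 - \<beta> \<le> measure_pmf.prob (run ?k x 1)
      {h. \<forall>t\<in>{1..1}. \<bar>?out (drop (1 - t) h) - Q (take t x)\<bar> \<le> \<alpha>}"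
    unfolding run by (simp add: vimage_def)
qed (use inst in \<open>auto simp: admissible_instance_def\<close>)

lemma pmf_run_pos:
  "(\<And>p h a. 0 < pmf (k p h) a) \<Longrightarrow> 0 < pmf (run k x (length h)) h"
  by (induction h) (simp_all add: pmf_run_Cons del: run.simps(2))

text \<open>Independent noise on the floors of \<open>Q\<close>, which differ by at most 1 on
  neighbouring streams. The moments of the \<open>T\<close> steps multiply; the error is the noise
  radius \<open>j\<close> plus 1 for the floor.\<close>

lemma achievable_gaussian:
  assumes inst: "admissible_instance d T \<beta> K Q X" and "0 < v" "0 < \<delta>"
    and budget: "real T * (v * real n * (real n + 1)) \<le> real n * \<epsilon> + ln \<delta>"
    and tail: "real T * exp (- (v * (real j)\<^sup>2)) \<le> \<beta>" and le: "real j + 1 \<le> \<alpha>"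
  shows "achievable d T Q X \<epsilon> \<delta> \<alpha> \<beta>"
  unfolding achievable_def
proof (rule realize_kernel)
  let ?g = "discrete_gaussian v"
  define k where "k = (\<lambda>p (h :: int list). shifted ?g \<lfloor>Q p :: real\<rfloor>)"
  have pos: "0 < pmf (k p h) a" for p h a
    using pmf_discrete_gaussian[OF \<open>0 < v\<close>] by (auto simp: k_def pmf_shifted)
  show "measure_pmf.prob (run k x T) E \<le> exp \<epsilon> * measure_pmf.prob (run k y T) E + \<delta>"
    if xy: "item_neighboring d T x y" for x y E
  proof (rule approx_dp_of_moment)
    fix h assume "pmf (run k y T) h = 0"
    then have "length h \<noteq> T" using pmf_run_pos[of k y h] pos by auto
    then show "pmf (run k x T) h = 0" using length_run by (metis set_pmf_iff)
  next
    define e where "e = exp (v * real n * (real n + 1))"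
    have "1 \<le> e" using \<open>0 < v\<close> by (simp add: e_def)
    have "(\<integral>\<^sup>+a. ennreal ((pmf (k (take (Suc (length h)) x) h) a /
              pmf (k (take (Suc (length h)) y) h) a) ^ n) * ennreal (e ^ (T - length (a # h)))
            \<partial>k (take (Suc (length h)) x) h) \<le> ennreal (e ^ (T - length h))" if h: "length h < T" for h
    proof -
      let ?\<mu> = "\<lfloor>Q (take (Suc (length h)) x)\<rfloor>" and ?\<nu> = "\<lfloor>Q (take (Suc (length h)) y)\<rfloor>"
      have "\<bar>Q (take (Suc (length h)) x) - Q (take (Suc (length h)) y)\<bar> \<le> 1"
        using inst xy h by (auto simp: admissible_instance_def item_sensitivity_le_one_def)
      then have "?\<mu> \<le> ?\<nu> + 1" "?\<nu> \<le> ?\<mu> + 1" by linarith+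
      then have "\<bar>?\<mu> - ?\<nu>\<bar> \<le> 1" by linarith
      then have "(?\<mu> - ?\<nu>)\<^sup>2 \<le> 1" by (simp add: abs_square_le_1)
      then have "real_of_int ((?\<mu> - ?\<nu>)\<^sup>2) \<le> real_of_int 1"
        by (rule of_int_le_iff[THEN iffD2])
      then have "(real_of_int (?\<mu> - ?\<nu>))\<^sup>2 \<le> 1" by simp
      then have "v * real n * (real n + 1) * (real_of_int (?\<mu> - ?\<nu>))\<^sup>2 \<le> v * real n * (real n + 1) * 1"
        using \<open>0 < v\<close> by (intro mult_left_mono) auto
      then have "exp (v * real n * (real n + 1) * (real_of_int (?\<mu> - ?\<nu>))\<^sup>2) \<le> e"
        by (simp add: e_def)
      then have "exp (v * real n * (real n + 1) * (real_of_int (?\<mu> - ?\<nu>))\<^sup>2) * e ^ (T - Suc (length h)) \<le>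
          e * e ^ (T - Suc (length h))"
        using \<open>1 \<le> e\<close> by (intro mult_right_mono) auto
      also have "\<dots> = e ^ (T - length h)"
        using h by (simp flip: power_Suc add: Suc_diff_Suc)
      finally have "ennreal (exp (v * real n * (real n + 1) * (real_of_int (?\<mu> - ?\<nu>))\<^sup>2)) *
          ennreal (e ^ (T - Suc (length h))) \<le> ennreal (e ^ (T - length h))"
        using \<open>1 \<le> e\<close> by (simp add: ennreal_mult[symmetric] ennreal_leI del: of_int_diff)
      then show ?thesis
        unfolding k_def length_Cons discrete_gaussian_moment[OF \<open>0 < v\<close>, symmetric]
        by (subst nn_integral_multc) auto
    qed
    from run_potential[where T = T and \<Psi> = "\<lambda>h. ennreal (e ^ (T - length h))", OF this order.refl]
    have "(\<integral>\<^sup>+h. ennreal ((pmf (run k x T) h / pmf (run k y T) h) ^ n) * ennreal (e ^ (T - length h))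
        \<partial>run k x T) \<le> ennreal (e ^ (T - length []))"
      by simp
    also have "(\<integral>\<^sup>+h. ennreal ((pmf (run k x T) h / pmf (run k y T) h) ^ n) * ennreal (e ^ (T - length h))
        \<partial>run k x T) = (\<integral>\<^sup>+h. ennreal ((pmf (run k x T) h / pmf (run k y T) h) ^ n) \<partial>run k x T)"
      by (intro nn_integral_cong_AE) (auto simp: AE_measure_pmf_iff dest: length_run)
    also have "e ^ (T - length []) = exp (real T * (v * real n * (real n + 1)))"
      by (simp add: e_def exp_of_nat_mult[symmetric])
    also have "ennreal \<dots> \<le> ennreal (exp (real n * \<epsilon> + ln \<delta>))"
      using budget by (intro ennreal_leI) simp
    finally show "(\<integral>\<^sup>+h. ennreal ((pmf (run k x T) h / pmf (run k y T) h) ^ n) \<partial>run k x T) \<le>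
        ennreal (exp (real n * \<epsilon>) * \<delta>)"
      using \<open>0 < \<delta>\<close> by (simp add: exp_add)
  qed (use \<open>0 < \<delta>\<close> in simp)
  fix x assume "x \<in> X"
  define bad where "bad = (\<lambda>(h :: int list) a. int j < \<bar>a - \<lfloor>Q (take (Suc (length h)) x)\<rfloor>\<bar>)"
  \<comment> \<open>Counts the outliers, so the expected cost is a union bound over the
    steps.\<close>
  define cost where "cost = rec_list (0 :: real) (\<lambda>a h c. c + of_bool (bad h a))"
  have cost: "cost [] = 0" "cost (a # h) = cost h + of_bool (bad h a)" for a h
    by (simp_all add: cost_def)
  have cost_nonneg: "0 \<le> cost h" for h by (induction h) (auto simp: cost)
  have cost_drop: "cost (drop i h) \<le> cost h" for i h
  proof (induction i arbitrary: h)
    case (Suc i)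
    have "cost (drop i h') \<le> cost (a # h')" for a h'
      using Suc[of h'] by (auto simp: cost intro: order.trans)
    then show ?case by (cases h) (auto simp: cost)
  qed simp
  let ?e = "exp (- (v * (real j)\<^sup>2))"
  have "(\<integral>\<^sup>+h. ennreal (cost h) \<partial>run k x T) \<le> ennreal (real T * ?e)"
  proof -
    have "(\<integral>\<^sup>+a. ennreal (cost (a # h) + real (T - length (a # h)) * ?e) \<partial>k (take (Suc (length h)) x) h) \<le>
        ennreal (cost h + real (T - length h) * ?e)" if h: "length h < T" for h
    proof -
      let ?p = "k (take (Suc (length h)) x) h" and ?r = "real (T - Suc (length h)) * ?e"
      have "(\<integral>\<^sup>+a. ennreal (cost (a # h) + real (T - length (a # h)) * ?e) \<partial>?p) =
          (\<integral>\<^sup>+a. ennreal (cost h + ?r) + indicator {a. bad h a} a \<partial>?p)"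
        using cost_nonneg[of h]
        by (intro nn_integral_cong) (auto simp: cost indicator_def add_ac simp flip: ennreal_plus ennreal_1)
      also have "\<dots> = ennreal (cost h + ?r) + ennreal (measure_pmf.prob ?p {a. bad h a})"
        by (subst nn_integral_add) (auto simp: measure_pmf.emeasure_eq_measure)
      also have "\<dots> \<le> ennreal (cost h + ?r) + ennreal ?e"
        using discrete_gaussian_tail[OF \<open>0 < v\<close>] by (intro add_left_mono ennreal_leI) (auto simp: k_def bad_def)
      also have "\<dots> = ennreal (cost h + real (T - length h) * ?e)"
      proof -
        have "T - length h = Suc (T - Suc (length h))" using h by simp
        then have "real (T - length h) * ?e = ?r + ?e" by (simp only: of_nat_Suc distrib_right mult_1 add.commute)
        then show ?thesis
          using cost_nonneg[of h] by (simp add: add.assoc flip: ennreal_plus)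
      qed
      finally show ?thesis .
    qed
    from run_expectation[where T = T and k = k and x = x and \<Psi> = "\<lambda>h. ennreal (cost h + real (T - length h) * ?e)", OF this]
    have "(\<integral>\<^sup>+h. ennreal (cost h + real (T - length h) * ?e) \<partial>run k x T) \<le>
        ennreal (cost [] + real (T - length []) * ?e)"
      by simp
    also have "(\<integral>\<^sup>+h. ennreal (cost h + real (T - length h) * ?e) \<partial>run k x T) =
        (\<integral>\<^sup>+h. ennreal (cost h) \<partial>run k x T)"
      by (intro nn_integral_cong_AE) (auto simp: AE_measure_pmf_iff dest: length_run)
    finally show ?thesis by (simp add: cost)
  qed
  then have "1 - real T * ?e \<le> measure_pmf.prob (run k x T)
      {h. \<forall>t\<in>{1..T}. \<bar>real_of_int (hd (drop (T - t) h)) - Q (take t x)\<bar> \<le> \<alpha>}"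
  proof (rule prob_run_ge_of_cost)
    fix h :: "int list" assume h: "length h = T" "cost h < 1"
    show "\<forall>t\<in>{1..T}. \<bar>real_of_int (hd (drop (T - t) h)) - Q (take t x)\<bar> \<le> \<alpha>"
    proof
      fix t assume t: "t \<in> {1..T}"
      then have "T - t < T" by auto
      then obtain a h' where ah: "drop (T - t) h = a # h'"
        using h by (cases "drop (T - t) h") auto
      have len: "Suc (length h') = t"
        using arg_cong[OF ah, of length] h t by simp
      have "cost (a # h') < 1" using cost_drop[of "T - t" h] h ah by simp
      then have "\<not> bad h' a" using cost_nonneg[of h'] by (auto simp: cost of_bool_def split: if_splits)
      then have "\<bar>a - \<lfloor>Q (take t x)\<rfloor>\<bar> \<le> int j" by (simp add: bad_def len)
      then show "\<bar>real_of_int (hd (drop (T - t) h)) - Q (take t x)\<bar> \<le> \<alpha>"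
        using le by (simp add: ah) linarith
    qed
  qed simp
  then show "1 - \<beta> \<le> measure_pmf.prob (run k x T)
      {h. \<forall>t\<in>{1..T}. \<bar>real_of_int (hd (drop (T - t) h)) - Q (take t x)\<bar> \<le> \<alpha>}"
    using tail by linarith
qed (use inst in \<open>auto simp: admissible_instance_def\<close>)

section \<open>Choosing the mechanism for each term of the bounds\<close>

lemma admissible_log:
  assumes inst: "admissible_instance d T \<beta> K Q X" and L: "L = ln (real T / \<beta>)"
  shows "0 < L"
    and "\<not> 2 \<le> real T / \<beta> \<Longrightarrow> T = 1 \<and> L \<le> 1"
    and "2 \<le> real T / \<beta> \<Longrightarrow> ln 2 \<le> L"
proof -
  have T: "1 \<le> T" and beta: "0 < \<beta>" "\<beta> < 1"
    using inst by (auto simp: admissible_instance_def)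
  have "1 < real T / \<beta>" using T beta by (simp add: less_divide_eq)
  then show "0 < L" by (simp add: L)
  show "ln 2 \<le> L" if "2 \<le> real T / \<beta>"
    using that by (simp add: L)
  assume "\<not> 2 \<le> real T / \<beta>"
  then have small: "real T / \<beta> < 2" by simp
  then have "real T < 2" using beta by (simp add: divide_less_eq)
  then have "T = 1" using T by simp
  moreover have "L \<le> 1"
    using ln_le_minus_one[of "real T / \<beta>"] \<open>1 < real T / \<beta>\<close> small by (simp add: L)
  ultimately show "T = 1 \<and> L \<le> 1" ..
qed

lemma achievable_pure:
  assumes inst: "admissible_instance d T \<beta> K Q X" and "0 < \<epsilon>"
  shows "achievable d T Q X \<epsilon> 0 (200 * pure_error_bound T \<beta> K \<epsilon>) \<beta>"
proof -
  define L where "L = ln (real T / \<beta>)"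
  have T: "1 \<le> T" using inst by (auto simp: admissible_instance_def)
  have L: "0 < L" using admissible_log(1)[OF inst L_def] .
  let ?b = "pure_error_bound T \<beta> K \<epsilon>"
  note const = achievable_constant[OF inst less_imp_le[OF \<open>0 < \<epsilon>\<close>] order.refl]
  have cases: "?b = K \<or> ?b = sqrt (K * L / \<epsilon>) \<or> ?b = real T * L / \<epsilon>"
    using Min_in[of "{K, sqrt (K * L / \<epsilon>), real T * L / \<epsilon>}"]
    by (auto simp: pure_error_bound_def L_def)
  show ?thesis
  proof (cases "K \<le> 0 \<or> ?b = K")
    case True
    then have "K \<le> 200 * ?b" if "0 \<le> K"
      using that cases L \<open>0 < \<epsilon>\<close> by auto
    then show ?thesis by (rule const)
  next
    case False
    then have K: "0 < K" by simp
    define r where "r = L / \<epsilon>"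
    have r: "0 < r" "K * L / \<epsilon> = K * r" "real T * L / \<epsilon> = real T * r" using L \<open>0 < \<epsilon>\<close> by (simp_all add: r_def)
    consider "K \<le> r" "?b = sqrt (K * r)" | "r < K" "?b = sqrt (K * r)" | "?b = real T * r"
      using cases False unfolding r(2) r(3) by (cases "K \<le> r") auto
    then show ?thesis
    proof cases
      case 1
      have "K \<le> ?b"
        unfolding 1(2) using 1(1) K by (intro real_le_rsqrt) (simp add: power2_eq_square)
      then show ?thesis using K by (intro const) simp
    next
      case 2
      have "r \<le> ?b"
        unfolding 2(2) using 2(1) r by (intro real_le_rsqrt) (simp add: power2_eq_square)
      show ?thesis
      proof (cases "2 \<le> real T / \<beta>")
        case True
        \<comment> \<open>With \<open>c\<close> of order \<open>\<epsilon> / k\<close>, the updates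
          suffice once \<open>k^2 * r\<close> exceeds \<open>K\<close>, and the error is of order
          \<open>k * r\<close>; the least such \<open>k\<close> is about
          \<open>\<rho>\<close>.\<close>
        define \<rho> where "\<rho> = sqrt (K / r)"
        have \<rho>: "1 \<le> \<rho>" "\<rho>\<^sup>2 = K / r" using 2(1) r K by (simp_all add: \<rho>_def)
        define k where "k = nat \<lfloor>\<rho>\<rfloor> + 1"
        have k: "\<rho> < real k" "real k \<le> 2 * \<rho>"
          using \<rho>(1) unfolding k_def by linarith+
        have "?b = \<rho> * r"
        proof -
          have "(\<rho> * r)\<^sup>2 = K * r"
            unfolding power_mult_distrib \<rho>(2) using r(1) by (simp add: power2_eq_square)
          then show ?thesis
            unfolding 2(2) using r(1) \<rho>(1) by (intro real_sqrt_unique) simp_all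
        qed
        show ?thesis
        proof (rule achievable_lazy[OF inst L_def True, where c = "\<epsilon> / (5 * real k)" and k = k])
          have "\<rho>\<^sup>2 < (real k)\<^sup>2" using k \<rho> by (intro power_strict_mono) auto
          then have "K < (real k)\<^sup>2 * r" using r by (simp add: \<rho>(2) divide_less_eq)
          also have "\<dots> \<le> real k * (4 * L / (\<epsilon> / (5 * real k)))"
          proof -
            have "(real k)\<^sup>2 * r \<le> 20 * ((real k)\<^sup>2 * r)" using r(1) by simp
            also have "\<dots> = real k * (4 * L / (\<epsilon> / (5 * real k)))"
              by (simp add: power2_eq_square r_def)
            finally show ?thesis .
          qed
          finally show "T \<le> k \<or> K < real k * (4 * L / (\<epsilon> / (5 * real k)))" ..
          have "20 * L / (\<epsilon> / (5 * real k)) = 100 * (real k * r)"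
            by (simp add: r_def)
          also have "\<dots> \<le> 100 * (2 * \<rho> * r)"
            using k r by simp
          finally show "20 * L / (\<epsilon> / (5 * real k)) \<le> 200 * ?b"
            using \<open>?b = \<rho> * r\<close> by simp
          have "(4 * real k + 1) * (\<epsilon> / (5 * real k)) \<le> 5 * real k * (\<epsilon> / (5 * real k))"
            using \<open>0 < \<epsilon>\<close> by (intro mult_right_mono) (auto simp: k_def)
          \<comment> \<open>The left disjunct is the pure budget; \<open>0\<close> is a placeholder
            for the moment order \<open>n\<close>.\<close>
          then show "0 = (0::real) \<and> (4 * real k + 1) * (\<epsilon> / (5 * real k)) \<le> \<epsilon> \<or>
            0 < (0::real) \<and> (real k + 1) * ((real 0 + 1/2)\<^sup>2 * (4 * (\<epsilon> / (5 * real k)))\<^sup>2 / 2) \<le> real 0 * \<epsilon> + ln 0"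
            by (simp add: k_def)
        qed (use \<open>0 < \<epsilon>\<close> in \<open>simp add: k_def\<close>)
      next
        case False
        then have [simp]: "T = 1" using admissible_log(2)[OF inst L_def] by simp
        have "3 * r \<le> 200 * ?b" using \<open>r \<le> ?b\<close> r by simp
        then show ?thesis
          using achievable_single_release[of d \<beta> K Q X \<epsilon> 0] inst \<open>0 < \<epsilon>\<close> by (simp add: r_def L_def)
      qed
    next
      case 3
      show ?thesis
      proof (cases "2 \<le> real T / \<beta>")
        case True
        show ?thesis
        proof (rule achievable_lazy[OF inst L_def True, where c = "\<epsilon> / (5 * real T)" and k = T])
          have "20 * L / (\<epsilon> / (5 * real T)) = 100 * ?b"
            unfolding 3 by (simp add: r_def)
          moreover have "0 \<le> ?b" unfolding 3 using r(1) by simp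
          ultimately show "20 * L / (\<epsilon> / (5 * real T)) \<le> 200 * ?b" by linarith
          have "(4 * real T + 1) * (\<epsilon> / (5 * real T)) \<le> 5 * real T * (\<epsilon> / (5 * real T))"
            using \<open>0 < \<epsilon>\<close> T by (intro mult_right_mono) auto
          then show "0 = (0::real) \<and> (4 * real T + 1) * (\<epsilon> / (5 * real T)) \<le> \<epsilon> \<or>
            0 < (0::real) \<and> (real T + 1) * ((real 0 + 1/2)\<^sup>2 * (4 * (\<epsilon> / (5 * real T)))\<^sup>2 / 2) \<le> real 0 * \<epsilon> + ln 0"
            using T by simp
        qed (use \<open>0 < \<epsilon>\<close> T in auto)
      next
        case False
        then have [simp]: "T = 1" using admissible_log(2)[OF inst L_def] by simp
        have "3 * r \<le> 200 * ?b" using 3 r by simp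
        then show ?thesis
          using achievable_single_release[of d \<beta> K Q X \<epsilon> 0] inst \<open>0 < \<epsilon>\<close> by (simp add: r_def L_def)
      qed
    qed
  qed
qed

text \<open>Here \<open>k\<close> phases cost order \<open>sqrt k\<close> instead of
  \<open>k\<close>, so \<open>4 * L / c\<close> is \<open>G * sqrt k\<close>. The variation is
  exhausted once \<open>G * k * sqrt k\<close> exceeds \<open>K\<close>, that is for
  \<open>k\<close> about \<open>(K / G)\<close> to the power 2/3, whence the cube root.\<close>

lemma achievable_lazy_approx:
  assumes inst: "admissible_instance d T \<beta> K Q X"
    and L: "L = ln (real T / \<beta>)" "2 \<le> real T / \<beta>"
    and pos: "0 < \<epsilon>" "0 < \<delta>" "0 < D" "0 < l" and n: "2 * l \<le> real n * \<epsilon>" "real n * \<epsilon> \<le> D * l" "1 \<le> n"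
    and l: "l = - ln \<delta>" and G: "G = 4 * L * sqrt (72 * D * l) / \<epsilon>" "0 < G" "G < K"
    and le: "10 * root 3 (K * G\<^sup>2) \<le> \<alpha>"
  shows "achievable d T Q X \<epsilon> \<delta> \<alpha> \<beta>"
proof -
  define \<rho> where "\<rho> = root 3 (K / G)"
  have \<rho>: "1 \<le> \<rho>" "\<rho> ^ 3 = K / G" using G(2,3) by (simp_all add: \<rho>_def)
  define k where "k = nat \<lfloor>\<rho>\<^sup>2\<rfloor> + 1"
  have "1 \<le> \<rho>\<^sup>2" using \<rho>(1) by simp
  then have k: "\<rho>\<^sup>2 < real k" "real k \<le> 2 * \<rho>\<^sup>2" "1 \<le> real k"
    unfolding k_def by linarith+
  \<comment> \<open>With \<open>k + 1 \<le> 2 * k\<close> and \<open>n + 1/2 \<le> 3/2 * n\<close>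
    the cost is at most \<open>36 * k * c^2 * n^2\<close>. The factor 72 brings it below
    \<open>n * \<epsilon> / 2\<close>; the other half of \<open>n * \<epsilon>\<close> pays for
    \<open>l\<close>.\<close>
  define S where "S = sqrt (72 * D * l)"
  have S: "0 < S" "S\<^sup>2 = 72 * D * l" using pos by (simp_all add: S_def)
  define c where "c = \<epsilon> / (S * sqrt (real k))"
  have c: "0 < c" "4 * L / c = G * sqrt (real k)" "20 * L / c = 5 * (G * sqrt (real k))"
    using pos k S unfolding G(1) S_def[symmetric] by (simp_all add: c_def)
  have sqrt_k: "\<rho> < sqrt (real k)" "sqrt (real k) \<le> 2 * \<rho>"
  proof -
    show "\<rho> < sqrt (real k)" using k(1) \<rho>(1) by (intro real_less_rsqrt)
    have "real k \<le> (2 * \<rho>)\<^sup>2" using k(2) \<open>1 \<le> \<rho>\<^sup>2\<close> by (simp add: power_mult_distrib)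
    then show "sqrt (real k) \<le> 2 * \<rho>" using \<rho>(1) by (intro real_le_lsqrt) auto
  qed
  show ?thesis
  proof (rule achievable_lazy[OF inst L, where c = c and k = k and n = n])
    have "K = \<rho>\<^sup>2 * (G * \<rho>)"
      using \<rho>(2) G(2) by (simp add: power2_eq_square power3_eq_cube field_simps)
    also have "\<dots> < real k * (G * sqrt (real k))"
    proof (rule mult_strict_mono)
      show "0 < real k" using k(3) by linarith
    qed (use k sqrt_k G(2) \<rho>(1) in auto)
    finally show "T \<le> k \<or> K < real k * (4 * L / c)" by (simp add: c)
    have "G * \<rho> = root 3 (K * G\<^sup>2)"
    proof (rule real_root_pos_unique[symmetric])
      show "(G * \<rho>) ^ 3 = K * G\<^sup>2"
        unfolding power_mult_distrib \<rho>(2) using G(2) by (simp add: power2_eq_square power3_eq_cube)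
    qed (use G(2,3) \<rho>(1) in auto)
    moreover have "5 * (G * sqrt (real k)) \<le> 5 * (G * (2 * \<rho>))"
      using sqrt_k G(2) by simp
    ultimately show "20 * L / c \<le> \<alpha>" unfolding c(3) using le by linarith
    have "c\<^sup>2 * (72 * D * l * real k) = \<epsilon>\<^sup>2"
      using S k pos by (simp add: c_def power_divide power_mult_distrib field_simps)
    then have c2: "72 * (real k * c\<^sup>2) * (D * l) = \<epsilon>\<^sup>2" by (simp add: mult_ac)
    have half: "(real n + 1/2)\<^sup>2 \<le> (3/2 * real n)\<^sup>2"
      using n(3) by (intro power_mono) auto
    have "(real k + 1) * ((real n + 1/2)\<^sup>2 * (4 * c)\<^sup>2 / 2) \<le>
        (2 * real k) * ((3/2 * real n)\<^sup>2 * (4 * c)\<^sup>2 / 2)"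
      using k(3) half by (intro mult_mono divide_right_mono mult_right_mono) auto
    also have "\<dots> = real n * (36 * (real k * c\<^sup>2) * real n)"
      by (simp add: power2_eq_square)
    also have "\<dots> \<le> real n * (\<epsilon> / 2)"
    proof (intro mult_left_mono)
      have "72 * (real k * c\<^sup>2) * (real n * \<epsilon>) \<le> 72 * (real k * c\<^sup>2) * (D * l)"
        using n(2) by (intro mult_left_mono) auto
      then have "(72 * (real k * c\<^sup>2) * real n) * \<epsilon> \<le> \<epsilon> * \<epsilon>"
        unfolding c2 by (simp add: power2_eq_square mult_ac)
      then have "72 * (real k * c\<^sup>2) * real n \<le> \<epsilon>" using pos by simp
      then show "36 * (real k * c\<^sup>2) * real n \<le> \<epsilon> / 2" by simp
    qed simp
    also have "\<dots> = real n * \<epsilon> / 2" by simp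
    also have "\<dots> \<le> real n * \<epsilon> + ln \<delta>" using n(1) l by linarith
    finally show "\<delta> = 0 \<and> (4 * real k + 1) * c \<le> \<epsilon> \<or>
      0 < \<delta> \<and> (real k + 1) * ((real n + 1/2)\<^sup>2 * (4 * c)\<^sup>2 / 2) \<le> real n * \<epsilon> + ln \<delta>"
      using pos by simp
  qed (use c in simp)
qed

text \<open>\<open>v\<close> keeps the total moment exponent below
  \<open>n * \<epsilon> / 2\<close>, and \<open>s\<close> solves \<open>v * s^2 = L\<close>, so that
  \<open>T\<close> tails add up to \<open>\<beta>\<close>. The summand 2 covers rounding
  \<open>s\<close> up and the floor of \<open>Q\<close>.\<close>

lemma achievable_gaussian_approx:
  assumes inst: "admissible_instance d T \<beta> K Q X"
    and L: "L = ln (real T / \<beta>)"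
    and pos: "0 < \<epsilon>" "0 < \<delta>" "0 < D" "0 < l" and n: "2 * l \<le> real n * \<epsilon>" "real n * \<epsilon> \<le> D * l" "1 \<le> n"
    and l: "l = - ln \<delta>"
    and le: "2 * sqrt D * (sqrt (real T * l * L) / \<epsilon>) + 2 \<le> \<alpha>"
  shows "achievable d T Q X \<epsilon> \<delta> \<alpha> \<beta>"
proof -
  have T: "1 \<le> T" and beta: "0 < \<beta>" using inst by (auto simp: admissible_instance_def)
  have "0 < L" using admissible_log(1)[OF inst L] .
  define v where "v = \<epsilon>\<^sup>2 / (4 * real T * (D * l))"
  have v: "0 < v" using pos T by (simp add: v_def)
  define s where "s = 2 * sqrt D * (sqrt (real T * l * L) / \<epsilon>)"
  have s: "0 \<le> s" "v * s\<^sup>2 = L"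
    using pos T \<open>0 < L\<close> by (simp_all add: s_def v_def power_mult_distrib power_divide)
  define j where "j = nat \<lceil>s\<rceil>"
  have j: "s \<le> real j" "real j \<le> s + 1" using s(1) unfolding j_def by linarith+
  show ?thesis
  proof (rule achievable_gaussian[OF inst v \<open>0 < \<delta>\<close>])
    have "4 * real T * v * (D * l) = \<epsilon> * \<epsilon>"
      using pos T by (simp add: v_def power2_eq_square)
    moreover have "4 * real T * v * (real n * \<epsilon>) \<le> 4 * real T * v * (D * l)"
      using n(2) v by (intro mult_left_mono) auto
    ultimately have "(4 * real T * v * real n) * \<epsilon> \<le> \<epsilon> * \<epsilon>" by (simp add: mult_ac)
    then have "4 * real T * v * real n \<le> \<epsilon>" using pos by simp
    then have "real n * (4 * real T * v * real n) \<le> real n * \<epsilon>" by (intro mult_left_mono) auto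
    moreover have "real T * (v * real n * (real n + 1)) \<le> real T * (v * real n * (2 * real n))"
      using n(3) v by (intro mult_left_mono) auto
    ultimately show "real T * (v * real n * (real n + 1)) \<le> real n * \<epsilon> + ln \<delta>"
      using n(1) l by (simp add: mult_ac)
    have "L \<le> v * (real j)\<^sup>2"
      unfolding s(2)[symmetric] using v s j by (intro mult_left_mono power_mono) auto
    then have "real T * exp (- (v * (real j)\<^sup>2)) \<le> real T * exp (- L)"
      by (intro mult_left_mono) simp_all
    also have "\<dots> = \<beta>" using T beta by (simp add: L exp_minus)
    finally show "real T * exp (- (v * (real j)\<^sup>2)) \<le> \<beta>" .
    show "real j + 1 \<le> \<alpha>" using j le by (simp add: s_def)
  qed
qed

lemma achievable_approx:
  assumes "0 < \<epsilon>\<^sub>0" "0 < \<delta>\<^sub>0" "\<delta>\<^sub>0 < 1"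
  shows "\<exists>C>0. \<forall>d T \<beta> K Q X. admissible_instance d T \<beta> K Q X \<longrightarrow>
    (\<forall>\<epsilon>\<in>{0<..\<epsilon>\<^sub>0}. \<forall>\<delta>\<in>{0<..\<delta>\<^sub>0}.
       achievable d T Q X \<epsilon> \<delta> (C * approx_error_bound T \<beta> K \<epsilon> \<delta>) \<beta>)"
proof -
  \<comment> \<open>\<open>l0\<close> bounds \<open>ln (1 / \<delta>)\<close> from below,
    \<open>D\<close> absorbs the rounding of the moment order, and \<open>g0\<close> bounds the
    \<open>sqrt T\<close> term from below when \<open>T / \<beta> \<ge> 2\<close>. Here the caps on
    \<open>\<epsilon>\<close> and \<open>\<delta>\<close> enter.\<close>
  define l0 D E g0 where "l0 = ln (1 / \<delta>\<^sub>0)" and "D = 2 + \<epsilon>\<^sub>0 / l0" and "E = root 3 (1152 * D)"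
    and "g0 = sqrt (l0 * ln 2) / \<epsilon>\<^sub>0"
  have l0: "0 < l0" using assms by (simp add: l0_def)
  have D: "0 < D" using l0 assms by (simp add: D_def add_pos_pos)
  have E: "0 < E" using D by (simp add: E_def)
  have g0: "0 < g0" using l0 assms by (simp add: g0_def)
  have r0: "0 < root 3 l0" "0 < sqrt l0" using l0 by simp_all
  \<comment> \<open>One summand per case: constant answer, Gaussian noise, lazy updates, and the
    cubic and square-root terms when \<open>T / \<beta> < 2\<close>.\<close>
  define C where "C = 1 + (2 * sqrt D + 2 / g0) + 10 * E + 3 / root 3 l0 + 3 / sqrt l0"
  have parts: "0 < 2 * sqrt D + 2 / g0" "0 < 3 / root 3 l0" "0 < 3 / sqrt l0"
    using D g0 r0 by (auto intro: add_pos_pos)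
  have C: "1 \<le> C" "2 * sqrt D + 2 / g0 \<le> C" "10 * E \<le> C" "3 / root 3 l0 \<le> C" "3 / sqrt l0 \<le> C"
    unfolding C_def using parts E by linarith+
  have "achievable d T Q X \<epsilon> \<delta> (C * approx_error_bound T \<beta> K \<epsilon> \<delta>) \<beta>"
    if inst: "admissible_instance d T \<beta> K Q X" and eps: "0 < \<epsilon>" "\<epsilon> \<le> \<epsilon>\<^sub>0" and del: "0 < \<delta>" "\<delta> \<le> \<delta>\<^sub>0"
    for d T \<beta> K Q X \<epsilon> \<delta>
  proof -
    define L l where "L = ln (real T / \<beta>)" and "l = ln (1 / \<delta>)"
    have T: "1 \<le> T" using inst by (auto simp: admissible_instance_def)
    have L: "0 < L" using admissible_log(1)[OF inst L_def] .
    have l_eq: "l = - ln \<delta>" using del by (simp add: l_def ln_div)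
    have l: "l0 \<le> l" "0 < l"
    proof -
      show "l0 \<le> l" unfolding l0_def l_def using del assms by (simp add: frac_le)
      then show "0 < l" using l0 by linarith
    qed
    \<comment> \<open>The least order at which \<open>n * \<epsilon>\<close> is twice
      \<open>ln (1 / \<delta>)\<close>.\<close>
    define n where "n = nat \<lceil>2 * l / \<epsilon>\<rceil>"
    have "0 < 2 * l / \<epsilon>" using l eps by simp
    then have "2 * l / \<epsilon> \<le> real n" "real n \<le> 2 * l / \<epsilon> + 1" "1 \<le> n"
      unfolding n_def by linarith+
    then have n: "2 * l \<le> real n * \<epsilon>" "real n * \<epsilon> \<le> 2 * l + \<epsilon>" "1 \<le> n"
      using eps by (simp_all add: field_simps)
    have "\<epsilon> \<le> \<epsilon>\<^sub>0 / l0 * l"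
    proof -
      have "\<epsilon>\<^sub>0 / l0 * l0 \<le> \<epsilon>\<^sub>0 / l0 * l" using l l0 assms by (intro mult_left_mono) auto
      then show ?thesis using l0 eps by simp
    qed
    then have nD: "real n * \<epsilon> \<le> D * l" using n(2) by (simp add: D_def distrib_right)
    let ?b = "approx_error_bound T \<beta> K \<epsilon> \<delta>"
    define R g where "R = root 3 (K * l * L\<^sup>2 / \<epsilon>\<^sup>2)" and "g = sqrt (real T * l * L) / \<epsilon>"
    note const = achievable_constant[OF inst less_imp_le[OF eps(1)] less_imp_le[OF del(1)]]
    have cases: "?b = K \<or> ?b = R \<or> ?b = g"
      using Min_in[of "{K, R, g}"]
      by (auto simp: approx_error_bound_def R_def g_def L_def l_def)
    have g: "0 < g" using T l L eps by (simp add: g_def)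
    show ?thesis
    proof (cases "K \<le> 0 \<or> ?b = K")
      case True
      then have "K \<le> C * ?b" if "0 \<le> K"
        using that cases g C(1) by (auto simp: R_def mult_le_cancel_right1)
      then show ?thesis by (rule const)
    next
      case False
      then have K: "0 < K" by simp
      define r where "r = L / \<epsilon>"
      have r: "0 < r" using L eps by (simp add: r_def)
      have R3: "R ^ 3 = K * l * r\<^sup>2" and R: "0 < R"
        using K l L eps by (simp_all add: R_def r_def power_divide)
      show ?thesis
      proof (cases "2 \<le> real T / \<beta>")
        case True
        show ?thesis
        proof (cases "?b = g")
          case True
          have "ln 2 \<le> L" using admissible_log(3)[OF inst L_def \<open>2 \<le> real T / \<beta>\<close>] .
          then have "l0 * ln 2 \<le> l * L" using l l0 by (intro mult_mono) auto
          also have "\<dots> \<le> real T * (l * L)"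
            using mult_right_mono[of 1 "real T" "l * L"] T l L by simp
          finally have "sqrt (l0 * ln 2) \<le> sqrt (real T * l * L)" by (simp add: mult.assoc)
          then have "g0 \<le> g" unfolding g0_def g_def using eps l L T by (intro frac_le) auto
          then have "2 \<le> 2 / g0 * g" using g0 by (simp add: field_simps)
          then have "2 * sqrt D * g + 2 \<le> (2 * sqrt D + 2 / g0) * g" by (simp add: distrib_right)
          also have "\<dots> \<le> C * ?b" unfolding True using C(2) g by (intro mult_right_mono) auto
          finally show ?thesis
            unfolding g_def
            by (intro achievable_gaussian_approx[OF inst L_def eps(1) del(1) D l(2) n(1) nD n(3) l_eq])
        next
          case not_g: False
          define G where "G = 4 * L * sqrt (72 * D * l) / \<epsilon>"
          have G: "0 < G" using L D l eps by (simp add: G_def)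
          have "G\<^sup>2 = 1152 * D * (l * r\<^sup>2)"
            using D l by (simp add: G_def r_def power_mult_distrib power_divide)
          then have "K * G\<^sup>2 = 1152 * D * R ^ 3" by (simp add: R3)
          then have root: "root 3 (K * G\<^sup>2) = E * R"
            using R by (simp add: E_def real_root_mult real_root_power_cancel)
          have "?b = R" using cases False not_g by auto
          have CR: "10 * (E * R) \<le> C * ?b"
          proof -
            have "10 * E * R \<le> C * R" using C(3) R by (intro mult_right_mono) auto
            then show ?thesis using \<open>?b = R\<close> by simp
          qed
          show ?thesis
          proof (cases "G < K")
            case True
            then show ?thesis
              using CR
              by (intro achievable_lazy_approx[OF inst L_def \<open>2 \<le> real T / \<beta>\<close> eps(1) del(1) D l(2) n(1) nD n(3)
                    l_eq G_def G True]) (simp add: root)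
          next
            case False
            \<comment> \<open>If \<open>G\<close> is at least \<open>K\<close>, the cube-root term
              already dominates \<open>K\<close> up to a constant, and the constant answer
              suffices.\<close>
            then have "K ^ 3 \<le> K * G\<^sup>2"
              using K by (simp add: power3_eq_cube power2_eq_square mult_mono)
            then have "root 3 (K ^ 3) \<le> root 3 (K * G\<^sup>2)" by simp
            then have "K \<le> E * R" using K by (simp add: root real_root_power_cancel)
            moreover have "0 < E * R" using E R by simp
            ultimately show ?thesis using CR by (intro const) linarith
          qed
        qed
      next
        case False
        then have T1: "T = 1" and "L \<le> 1" using admissible_log(2)[OF inst L_def] by auto
        have release: ?thesis if "3 * r \<le> C * ?b"
          using achievable_single_release[of d \<beta> K Q X \<epsilon> \<delta>] inst eps del that
          by (simp add: r_def L_def T1)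
        show ?thesis
        proof (cases "?b = g")
          case True
          have "sqrt l0 * L \<le> sqrt (l * L)"
          proof -
            have "L * L \<le> 1 * L" using \<open>L \<le> 1\<close> L by (intro mult_right_mono) auto
            then have "l0 * (L * L) \<le> l * L" using l l0 L by (intro mult_mono) auto
            then show ?thesis
              using l0 by (intro real_le_rsqrt) (simp add: power_mult_distrib power2_eq_square[of L])
          qed
          then have "sqrt l0 * r \<le> g"
            using eps unfolding g_def r_def T1 by (simp add: divide_right_mono)
          then have "3 * r \<le> 3 / sqrt l0 * g" using r0 by (simp add: field_simps)
          also have "\<dots> \<le> C * ?b" unfolding True using C(5) g by (intro mult_right_mono) auto
          finally show ?thesis by (rule release)
        next
          case not_g: False
          then have "?b = R" using cases \<open>\<not> (K \<le> 0 \<or> ?b = K)\<close> by auto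
          \<comment> \<open>Applied to the smaller of \<open>K\<close> and \<open>r\<close>: the
            constant answer has error \<open>K\<close>, the single release error
            \<open>3 * r\<close>.\<close>
          have bound: "3 * z \<le> C * ?b" if z: "0 < z" "z \<le> K" "z \<le> r" for z
          proof -
            have "z * z\<^sup>2 \<le> K * r\<^sup>2" using z by (intro mult_mono power_mono) auto
            then have "l0 * (z * z\<^sup>2) \<le> l * (K * r\<^sup>2)" using l l0 z by (intro mult_mono) auto
            then have "l0 * z ^ 3 \<le> R ^ 3"
              unfolding R3 by (simp add: power3_eq_cube power2_eq_square mult_ac)
            then have "root 3 (l0 * z ^ 3) \<le> root 3 (R ^ 3)" by simp
            then have "root 3 l0 * z \<le> R"
              using z R by (simp add: real_root_mult real_root_power_cancel)
            then have "3 * z \<le> 3 / root 3 l0 * R" using r0 by (simp add: field_simps)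
            also have "\<dots> \<le> C * R" using C(4) R by (intro mult_right_mono) auto
            finally show ?thesis using \<open>?b = R\<close> by simp
          qed
          show ?thesis
          proof (cases "K \<le> r")
            case True
            then show ?thesis using bound[of K] K by (intro const) simp
          next
            case False
            then show ?thesis using bound[of r] r by (intro release) simp
          qed
        qed
      qed
    qed
  qed
  then show ?thesis
    using C(1) by (intro exI[of _ C]) auto
qed

theorem theorem1p6:
  shows "(\<exists>C>0. \<forall>d T \<beta> K Q X. admissible_instance d T \<beta> K Q X \<longrightarrow>
            (\<forall>\<epsilon>>0. \<exists>M A.
               continual_algorithm M A \<and>
               item_level_pure_dp d T \<epsilon> M A \<and>
               accurate T Q X M A (C * pure_error_bound T \<beta> K \<epsilon>) \<beta>)) \<and>
         (\<forall>\<epsilon>\<^sub>0>0. \<forall>\<delta>\<^sub>0\<in>{0<..<1}. \<exists>C>0. \<forall>d T \<beta> K Q X. admissible_instance d T \<beta> K Q X \<longrightarrow>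
            (\<forall>\<epsilon>\<in>{0<..\<epsilon>\<^sub>0}. \<forall>\<delta>\<in>{0<..\<delta>\<^sub>0}. \<exists>M A.
               continual_algorithm M A \<and>
               item_level_dp d T \<epsilon> \<delta> M A \<and>
               accurate T Q X M A (C * approx_error_bound T \<beta> K \<epsilon> \<delta>) \<beta>))"
proof
  show "\<exists>C>0. \<forall>d T \<beta> K Q X. admissible_instance d T \<beta> K Q X \<longrightarrow>
            (\<forall>\<epsilon>>0. \<exists>M A.
               continual_algorithm M A \<and>
               item_level_pure_dp d T \<epsilon> M A \<and>
               accurate T Q X M A (C * pure_error_bound T \<beta> K \<epsilon>) \<beta>)"
    unfolding item_level_pure_dp_def achievable_def[symmetric]
    using achievable_pure by (intro exI[of _ 200]) auto
  show "\<forall>\<epsilon>\<^sub>0>0. \<forall>\<delta>\<^sub>0\<in>{0<..<1}. \<exists>C>0. \<forall>d T \<beta> K Q X. admissible_instance d T \<beta> K Q X \<longrightarrow>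
            (\<forall>\<epsilon>\<in>{0<..\<epsilon>\<^sub>0}. \<forall>\<delta>\<in>{0<..\<delta>\<^sub>0}. \<exists>M A.
               continual_algorithm M A \<and>
               item_level_dp d T \<epsilon> \<delta> M A \<and>
               accurate T Q X M A (C * approx_error_bound T \<beta> K \<epsilon> \<delta>) \<beta>)"
    unfolding achievable_def[symmetric] using achievable_approx by auto
qed

end
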